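(* Let $A$ be a nonzero commutative Artinian ring and let $R=A[Z_1,Z_2,Z_3,Y]$ be the polynomial super-ring over $A$ with free odd generators $Z_1,Z_2,Z_3,Y$. There exists a nonzero $R$-supermodule $M$ such that $Y$ is an odd $M$-regular element but $$\mathrm{sdim}_1(M/YM)<\mathrm{sdim}_1(M)-1.$$ In particular, $Y$ cannot be included in any longest system of odd parameters of $M$.
   Context: A super-ring is a unital associative $\mathbb{Z}_2$-graded ring $R=R_0\oplus R_1$, super-commutative: $ab=(-1)^{|a||b|}ba$ for homogeneous $a,b$, and $a^2=0$ for odd $a$. The polynomial super-ring on odd generators over a commutative ring $A$ is the exterior algebra over $A$ on these generators. Supermodules are $\mathbb{Z}_2$-graded modules. For a nonzero $R$-supermodule $N$: $\dim(N)=\mathrm{Kdim}(R_0/\mathrm{Ann}_{R_0}(N))$ (with $\dim(0)=-\infty$); a collection $y_1,\dots,y_l\in R_1$ ($l\ge1$) is a system of odd parameters of $N$ if $\dim(y_1\cdots y_lN)=\dim(N)$; $\mathrm{sdim}_1(N)$ is the largest length of a system of odd parameters of $N$, or $0$ if there is none; a system is longest if its length is $\mathrm{sdim}_1(N)$. An odd element $r\in R_1$ is $N$-regular if the kernel of $N\to N$, $m\mapsto rm$, equals $rN$. *)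

theory Defs
  imports "HOL-Algebra.Module" "HOL-Algebra.QuotRing" "HOL-Library.Extended_Real"
begin

section \<open>Artinian rings and Krull dimension\<close>

locale artinian_cring = cring +
  assumes descending_chain:
    "\<lbrakk>\<And>n::nat. ideal (I n) R; \<And>n. I (Suc n) \<subseteq> I n\<rbrakk> \<Longrightarrow> \<exists>N. \<forall>n\<ge>N. I n = I N"

text \<open>The supremum is taken in the extended reals, so that the zero ring, which has no prime
  ideals, has dimension \<open>-\<infinity>\<close>.\<close>

definition Kdim :: "('a, 'b) ring_scheme \<Rightarrow> ereal" where
  "Kdim S = Sup {ereal (real n) | n.
     \<exists>P. (\<forall>i\<le>n. primeideal (P i) S) \<and> (\<forall>i<n. P i \<subset> P (Suc i))}"


section \<open>Super-rings and supermodules\<close>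

text \<open>Parities are booleans: \<open>False\<close> is even, \<open>True\<close> is odd, and addition in
  \<open>\<int>\<^sub>2\<close> is \<open>\<noteq>\<close>.\<close>

definition Z2_grading :: "('a, 'b) ring_scheme \<Rightarrow> (bool \<Rightarrow> 'a set) \<Rightarrow> bool" where
  "Z2_grading G H \<longleftrightarrow>
     (\<forall>p. additive_subgroup (H p) G) \<and>
     carrier G = H False <+>\<^bsub>G\<^esub> H True \<and>
     H False \<inter> H True = {\<zero>\<^bsub>G\<^esub>}"

record 'a super_ring = "'a ring" +
  rpart :: "bool \<Rightarrow> 'a set"

locale super_ring = ring R for R :: "('a, 'b) super_ring_scheme" (structure) +
  assumes grading: "Z2_grading R (rpart R)"
    and mult_part: "\<lbrakk>a \<in> rpart R p; b \<in> rpart R q\<rbrakk> \<Longrightarrow> a \<otimes> b \<in> rpart R (p \<noteq> q)"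
    and super_comm: "\<lbrakk>a \<in> rpart R p; b \<in> rpart R q\<rbrakk> \<Longrightarrow>
      a \<otimes> b = (if p \<and> q then \<ominus> (b \<otimes> a) else b \<otimes> a)"
    and odd_square: "a \<in> rpart R True \<Longrightarrow> a \<otimes> a = \<zero>"

definition even_ring :: "('a, 'b) super_ring_scheme \<Rightarrow> ('a, 'b) super_ring_scheme" where
  "even_ring R = R\<lparr>carrier := rpart R False\<rparr>"

text \<open>As for the library's \<^typ>\<open>('a, 'b) module\<close> record, the multiplicative fields
  inherited from \<^typ>\<open>'b ring\<close> play no role for supermodules.\<close>

record ('a, 'b) supermodule = "('a, 'b) module" +
  mpart :: "bool \<Rightarrow> 'b set"

locale supermodule = R?: super_ring R + M?: abelian_group M
  for R :: "('a, 'd) super_ring_scheme" (structure) and M :: "('a, 'b, 'c) supermodule_scheme" (structure) +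
  assumes smult_closed: "\<lbrakk>a \<in> carrier R; x \<in> carrier M\<rbrakk> \<Longrightarrow> a \<odot>\<^bsub>M\<^esub> x \<in> carrier M"
    and smult_l_distr: "\<lbrakk>a \<in> carrier R; b \<in> carrier R; x \<in> carrier M\<rbrakk> \<Longrightarrow>
      (a \<oplus> b) \<odot>\<^bsub>M\<^esub> x = a \<odot>\<^bsub>M\<^esub> x \<oplus>\<^bsub>M\<^esub> b \<odot>\<^bsub>M\<^esub> x"
    and smult_r_distr: "\<lbrakk>a \<in> carrier R; x \<in> carrier M; y \<in> carrier M\<rbrakk> \<Longrightarrow>
      a \<odot>\<^bsub>M\<^esub> (x \<oplus>\<^bsub>M\<^esub> y) = a \<odot>\<^bsub>M\<^esub> x \<oplus>\<^bsub>M\<^esub> a \<odot>\<^bsub>M\<^esub> y"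
    and smult_assoc: "\<lbrakk>a \<in> carrier R; b \<in> carrier R; x \<in> carrier M\<rbrakk> \<Longrightarrow>
      (a \<otimes> b) \<odot>\<^bsub>M\<^esub> x = a \<odot>\<^bsub>M\<^esub> (b \<odot>\<^bsub>M\<^esub> x)"
    and smult_one: "x \<in> carrier M \<Longrightarrow> \<one> \<odot>\<^bsub>M\<^esub> x = x"
    and mgrading: "Z2_grading M (mpart M)"
    and smult_part: "\<lbrakk>a \<in> rpart R p; x \<in> mpart M q\<rbrakk> \<Longrightarrow> a \<odot>\<^bsub>M\<^esub> x \<in> mpart M (p \<noteq> q)"

text \<open>\<open>r N\<close> and \<open>N / r N\<close>. For homogeneous \<open>r\<close> the set \<open>{r n | n \<in> N}\<close> is already
  a graded submodule, by super-commutativity.\<close>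

definition mult_submodule :: "'a \<Rightarrow> ('a, 'b, 'c) supermodule_scheme \<Rightarrow> ('a, 'b, 'c) supermodule_scheme"
  where "mult_submodule r N = N\<lparr>
     carrier := (\<lambda>n. r \<odot>\<^bsub>N\<^esub> n) ` carrier N,
     mpart := (\<lambda>p. mpart N p \<inter> (\<lambda>n. r \<odot>\<^bsub>N\<^esub> n) ` carrier N)\<rparr>"

definition quotient_supermodule ::
    "('a, 'b, 'c) supermodule_scheme \<Rightarrow> 'b set \<Rightarrow> ('a, 'b set) supermodule" where
  "quotient_supermodule M N = \<lparr>
     carrier = a_rcosets\<^bsub>M\<^esub> N,
     mult = undefined,
     one = undefined,
     zero = N,
     add = (\<lambda>C D. C <+>\<^bsub>M\<^esub> D),
     smult = (\<lambda>r C. \<Union>x\<in>C. N +>\<^bsub>M\<^esub> (r \<odot>\<^bsub>M\<^esub> x)),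
     mpart = (\<lambda>p. (\<lambda>x. N +>\<^bsub>M\<^esub> x) ` mpart M p)\<rparr>"


section \<open>Dimension, odd parameters and odd regular elements\<close>

definition even_ann ::
    "('a, 'd) super_ring_scheme \<Rightarrow> ('a, 'b, 'c) supermodule_scheme \<Rightarrow> 'a set" where
  "even_ann R N = {r \<in> rpart R False. \<forall>n\<in>carrier N. r \<odot>\<^bsub>N\<^esub> n = \<zero>\<^bsub>N\<^esub>}"

definition sdim ::
    "('a, 'd) super_ring_scheme \<Rightarrow> ('a, 'b, 'c) supermodule_scheme \<Rightarrow> ereal" where
  "sdim R N = (if carrier N = {\<zero>\<^bsub>N\<^esub>} then -\<infinity> else Kdim (even_ring R Quot even_ann R N))"

definition odd_parameters ::
    "('a, 'd) super_ring_scheme \<Rightarrow> ('a, 'b, 'c) supermodule_scheme \<Rightarrow> 'a list \<Rightarrow> bool" where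
  "odd_parameters R N ys \<longleftrightarrow>
     ys \<noteq> [] \<and> set ys \<subseteq> rpart R True \<and>
     sdim R (mult_submodule (foldr (\<lambda>a b. a \<otimes>\<^bsub>R\<^esub> b) ys \<one>\<^bsub>R\<^esub>) N) = sdim R N"

text \<open>Note \<open>Sup {} = 0\<close> in \<^typ>\<open>enat\<close>; if the lengths are unbounded the value is \<open>\<infinity>\<close>.\<close>

definition sdim1 ::
    "('a, 'd) super_ring_scheme \<Rightarrow> ('a, 'b, 'c) supermodule_scheme \<Rightarrow> enat" where
  "sdim1 R N = Sup {enat (length ys) | ys. odd_parameters R N ys}"

definition longest_odd_parameters ::
    "('a, 'd) super_ring_scheme \<Rightarrow> ('a, 'b, 'c) supermodule_scheme \<Rightarrow> 'a list \<Rightarrow> bool" where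
  "longest_odd_parameters R N ys \<longleftrightarrow> odd_parameters R N ys \<and> enat (length ys) = sdim1 R N"

definition odd_regular ::
    "('a, 'd) super_ring_scheme \<Rightarrow> ('a, 'b, 'c) supermodule_scheme \<Rightarrow> 'a \<Rightarrow> bool" where
  "odd_regular R N r \<longleftrightarrow> r \<in> rpart R True \<and>
     {m \<in> carrier N. r \<odot>\<^bsub>N\<^esub> m = \<zero>\<^bsub>N\<^esub>} = (\<lambda>n. r \<odot>\<^bsub>N\<^esub> n) ` carrier N"


section \<open>Polynomial super-rings\<close>

text \<open>The exterior algebra over \<open>A\<close> on odd generators indexed by a finite set \<open>V\<close> of naturals:
  a family \<open>f\<close> stands for the sum over \<open>S \<subseteq> V\<close> of \<open>f S\<close> times the product of the generators
  in \<open>S\<close> in increasing order. The product of the monomials of disjoint sets \<open>S\<close>, \<open>T\<close> is the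
  monomial of \<open>S \<union> T\<close> up to the sign of the shuffle, which counts the inversions.\<close>

definition inversions :: "nat set \<Rightarrow> nat set \<Rightarrow> nat" where
  "inversions S T = card {(i, j) \<in> S \<times> T. j < i}"

definition shuffle_sign :: "('a, 'b) ring_scheme \<Rightarrow> nat set \<Rightarrow> nat set \<Rightarrow> 'a" where
  "shuffle_sign A S T = (if even (inversions S T) then \<one>\<^bsub>A\<^esub> else \<ominus>\<^bsub>A\<^esub> \<one>\<^bsub>A\<^esub>)"

definition poly_super_ring ::
    "('a, 'b) ring_scheme \<Rightarrow> nat set \<Rightarrow> (nat set \<Rightarrow> 'a) super_ring" where
  "poly_super_ring A V = (let C = {f. (\<forall>S. f S \<in> carrier A) \<and> (\<forall>S. \<not> S \<subseteq> V \<longrightarrow> f S = \<zero>\<^bsub>A\<^esub>)} in \<lparr>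
     carrier = C,
     mult = (\<lambda>f g S. \<Oplus>\<^bsub>A\<^esub>T\<in>Pow S. shuffle_sign A T (S - T) \<otimes>\<^bsub>A\<^esub> (f T \<otimes>\<^bsub>A\<^esub> g (S - T))),
     one = (\<lambda>S. if S = {} then \<one>\<^bsub>A\<^esub> else \<zero>\<^bsub>A\<^esub>),
     zero = (\<lambda>S. \<zero>\<^bsub>A\<^esub>),
     add = (\<lambda>f g S. f S \<oplus>\<^bsub>A\<^esub> g S),
     rpart = (\<lambda>p. {f \<in> C. \<forall>S. f S \<noteq> \<zero>\<^bsub>A\<^esub> \<longrightarrow> odd (card S) = p})\<rparr>)"

definition odd_gen :: "('a, 'b) ring_scheme \<Rightarrow> nat \<Rightarrow> nat set \<Rightarrow> 'a" where
  "odd_gen A i = (\<lambda>S. if S = {i} then \<one>\<^bsub>A\<^esub> else \<zero>\<^bsub>A\<^esub>)"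

end

theory Submission
  imports Defs "HOL-Algebra.Ring_Divisibility" "HOL-Library.Nat_Bijection"
begin

text \<open>Since \<open>A\<close> is Artinian, every nonzero supermodule has dimension \<open>0\<close>, so \<open>y\<^sub>1, \<dots>, y\<^sub>l\<close> are odd
  parameters of \<open>N \<noteq> 0\<close> iff \<open>y\<^sub>1 \<cdots> y\<^sub>l N \<noteq> 0\<close>. It thus suffices to find \<open>M\<close> such that \<open>Y\<close> is
  \<open>M\<close>-regular, products of two odd elements map \<open>M\<close> into \<open>Y M\<close>, and \<open>Z\<^sub>1 Z\<^sub>2 Z\<^sub>3 M \<noteq> 0\<close>: then
  the odd dimension of \<open>M / Y M\<close> is at most \<open>1\<close> and that of \<open>M\<close> at least \<open>3\<close>, while a product of
  three odd elements involving \<open>Y\<close> annihilates \<open>M\<close>.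

  Adjoin three more odd generators \<open>a\<^sub>1, a\<^sub>2, a\<^sub>3\<close>, let \<open>J\<close> be the ideal of \<open>R\<close> generated by the
  products \<open>Z\<^sub>i Z\<^sub>j\<close>, put \<open>e = Z\<^sub>2 Z\<^sub>3 a\<^sub>1 + Z\<^sub>1 Z\<^sub>3 a\<^sub>2 + Z\<^sub>1 Z\<^sub>2 a\<^sub>3 + Y\<close>, and take \<open>M = R e + J\<close>. As
  \<open>J\<close> annihilates \<open>J\<close> and \<open>e - Y\<close>, it satisfies \<open>J M \<subseteq> J Y = Y J \<subseteq> Y M\<close>. The \<open>a\<^sub>i\<close> make \<open>Y\<close> regular:
  if \<open>Y (r e + s) = 0\<close> with \<open>s \<in> J\<close>, then comparing coefficients gives \<open>r \<in> Y R + J\<close>.\<close>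

section \<open>The polynomial super-ring\<close>

lemma (in comm_monoid) finprod_finprod_Sigma:
  assumes "finite I" "\<And>i. i \<in> I \<Longrightarrow> finite (J i)"
    and "\<And>i j. i \<in> I \<Longrightarrow> j \<in> J i \<Longrightarrow> f i j \<in> carrier G"
  shows "finprod G (\<lambda>i. finprod G (f i) (J i)) I = finprod G (\<lambda>(i, j). f i j) (Sigma I J)"
proof -
  have "finprod G (\<lambda>(i, j). f i j) (Sigma I J)
      = finprod G (\<lambda>(i, j). f i j) (\<Union>i\<in>I. Pair i ` J i)"
    by (rule arg_cong[of _ _ "finprod G _"]) auto
  also have "\<dots> = finprod G (\<lambda>i. finprod G (\<lambda>(i, j). f i j) (Pair i ` J i)) I"
    using assms by (intro finprod_UN_disjoint) (auto simp: pairwise_def disjnt_def)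
  also have "\<dots> = finprod G (\<lambda>i. finprod G (f i) (J i)) I"
    using assms by (intro finprod_cong' refl)
      (auto simp: Pi_def intro!: finprod_closed, subst finprod_reindex, auto simp: inj_on_def)
  finally show ?thesis by simp
qed

lemma inversions_Un_left:
  assumes "finite S" "finite T" "finite U" "S \<inter> T = {}"
  shows "inversions (S \<union> T) U = inversions S U + inversions T U"
proof -
  have "{(i, j) \<in> (S \<union> T) \<times> U. j < i} = {(i, j) \<in> S \<times> U. j < i} \<union> {(i, j) \<in> T \<times> U. j < i}"
    by auto
  moreover have "finite {(i, j) \<in> S \<times> U. j < i}" "finite {(i, j) \<in> T \<times> U. j < i}"
    using assms by (auto intro: finite_subset[of _ "S \<times> U"] finite_subset[of _ "T \<times> U"])
  ultimately show ?thesis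
    unfolding inversions_def using assms by (auto simp: card_Un_disjoint disjoint_iff)
qed

lemma inversions_Un_right:
  assumes "finite S" "finite T" "finite U" "T \<inter> U = {}"
  shows "inversions S (T \<union> U) = inversions S T + inversions S U"
proof -
  have "{(i, j) \<in> S \<times> (T \<union> U). j < i} = {(i, j) \<in> S \<times> T. j < i} \<union> {(i, j) \<in> S \<times> U. j < i}"
    by auto
  moreover have "finite {(i, j) \<in> S \<times> T. j < i}" "finite {(i, j) \<in> S \<times> U. j < i}"
    using assms by (auto intro: finite_subset[of _ "S \<times> T"] finite_subset[of _ "S \<times> U"])
  ultimately show ?thesis
    unfolding inversions_def using assms by (auto simp: card_Un_disjoint disjoint_iff)
qed

text \<open>Members of disjoint sets are never equal, so each pair is an inversion in exactly one of
  the two orders. This count yields the sign rule for odd elements.\<close>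

lemma inversions_swap:
  assumes "finite S" "finite T" "S \<inter> T = {}"
  shows "inversions S T + inversions T S = card S * card T"
proof -
  let ?A = "{(i, j) \<in> S \<times> T. j < i}" and ?B = "{(i, j) \<in> S \<times> T. i < j}"
  have "inversions T S = card ?B"
    unfolding inversions_def
    by (rule bij_betw_same_card[of prod.swap], rule bij_betwI[where g = prod.swap]) auto
  moreover have "card (?A \<union> ?B) = card ?A + card ?B"
    using assms by (intro card_Un_disjoint) (auto intro: finite_subset[of _ "S \<times> T"])
  moreover have "?A \<union> ?B = S \<times> T"
    using assms(3) nat_neq_iff by blast
  ultimately show ?thesis
    by (simp add: inversions_def card_cartesian_product)
qed

lemma inversions_empty [simp]: "inversions {} T = 0" "inversions T {} = 0"
  by (simp_all add: inversions_def)

section \<open>Ring structure of the exterior algebra in coordinates\<close>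

locale exterior_algebra = A?: cring A for A (structure) +
  fixes V :: "nat set"
  assumes finite_V: "finite V"
begin

abbreviation P :: "(nat set \<Rightarrow> 'a) super_ring" where "P \<equiv> poly_super_ring A V"

text \<open>The sign \<open>(-1)^n\<close> as an element of \<open>A\<close>. Taking the exponent as
  argument turns addition of inversion counts into multiplication of signs.\<close>

definition psign :: "nat \<Rightarrow> 'a" where "psign n = (if even n then \<one> else \<ominus> \<one>)"

lemma psign_closed [simp]: "psign n \<in> carrier A"
  by (simp add: psign_def)

lemma psign_add: "psign (m + n) = psign m \<otimes> psign n"
  by (auto simp: psign_def l_minus)

lemma shuffle_sign_eq: "shuffle_sign A S T = psign (inversions S T)"
  by (simp add: shuffle_sign_def psign_def)

lemma psign_mult_eq_zero_iff: "x \<in> carrier A \<Longrightarrow> psign n \<otimes> x = \<zero> \<longleftrightarrow> x = \<zero>"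
  by (auto simp: psign_def l_minus)

lemma P_carrier: "f \<in> carrier P \<longleftrightarrow> (\<forall>S. f S \<in> carrier A) \<and> (\<forall>S. \<not> S \<subseteq> V \<longrightarrow> f S = \<zero>)"
  by (simp add: poly_super_ring_def Let_def)

lemma P_carrierD: "f \<in> carrier P \<Longrightarrow> f S \<in> carrier A"
  by (simp add: P_carrier)

lemma P_outside: "f \<in> carrier P \<Longrightarrow> \<not> S \<subseteq> V \<Longrightarrow> f S = \<zero>"
  by (simp add: P_carrier)

lemma P_mult: "(f \<otimes>\<^bsub>P\<^esub> g) S
    = (\<Oplus>T\<in>Pow S. psign (inversions T (S - T)) \<otimes> (f T \<otimes> g (S - T)))"
  by (simp add: poly_super_ring_def Let_def shuffle_sign_eq)

lemma P_add: "(f \<oplus>\<^bsub>P\<^esub> g) S = f S \<oplus> g S"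
  by (simp add: poly_super_ring_def Let_def)

lemma P_zero: "\<zero>\<^bsub>P\<^esub> S = \<zero>"
  by (simp add: poly_super_ring_def Let_def)

lemma P_one: "\<one>\<^bsub>P\<^esub> S = (if S = {} then \<one> else \<zero>)"
  by (simp add: poly_super_ring_def Let_def)

lemma P_rpart: "f \<in> rpart P p \<longleftrightarrow> f \<in> carrier P \<and> (\<forall>S. f S \<noteq> \<zero> \<longrightarrow> odd (card S) = p)"
  by (simp add: poly_super_ring_def Let_def)

text \<open>Any splitting of such an \<open>S\<close> has a part outside \<open>V\<close>, so every
  summand is zero. Infinite \<open>S\<close> are included, which lets later proofs pass to finite
  \<open>S\<close>.\<close>

lemma P_mult_outside:
  assumes "f \<in> carrier P" "g \<in> carrier P" "\<not> S \<subseteq> V"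
  shows "(f \<otimes>\<^bsub>P\<^esub> g) S = \<zero>"
  unfolding P_mult
proof (rule add.finprod_one_eqI)
  fix T assume "T \<in> Pow S"
  then have "\<not> T \<subseteq> V \<or> \<not> S - T \<subseteq> V" using assms(3) by blast
  then show "psign (inversions T (S - T)) \<otimes> (f T \<otimes> g (S - T)) = \<zero>"
    using assms(1,2) P_outside P_carrierD by (metis l_null r_null psign_closed)
qed

lemma P_mult_closed:
  assumes "f \<in> carrier P" "g \<in> carrier P"
  shows "f \<otimes>\<^bsub>P\<^esub> g \<in> carrier P"
  unfolding P_carrier
  using P_mult_outside[OF assms] assms by (auto simp: P_mult P_carrierD intro!: finsum_closed)

lemma P_add_closed: "f \<in> carrier P \<Longrightarrow> g \<in> carrier P \<Longrightarrow> f \<oplus>\<^bsub>P\<^esub> g \<in> carrier P"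
  by (simp add: P_carrier P_add)

lemma abelian_group_P: "abelian_group P"
proof (rule abelian_groupI)
  fix f assume f: "f \<in> carrier P"
  show "\<exists>g\<in>carrier P. g \<oplus>\<^bsub>P\<^esub> f = \<zero>\<^bsub>P\<^esub>"
    by (rule bexI[of _ "\<lambda>S. \<ominus> f S"])
       (use f in \<open>auto simp: P_add P_zero P_carrier fun_eq_iff l_neg\<close>)
qed (auto simp: P_carrier P_add P_zero fun_eq_iff a_ac)

interpretation PG: abelian_group P by (rule abelian_group_P)

lemma P_uminus: "f \<in> carrier P \<Longrightarrow> (\<ominus>\<^bsub>P\<^esub> f) S = \<ominus> f S"
  by (metis P_add P_carrierD PG.a_inv_closed PG.l_neg P_zero minus_equality)

text \<open>Both sides at \<open>S\<close> are the same sum over ordered partitions of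
  \<open>S\<close> into three blocks. The signs agree because inversions are additive over disjoint
  unions in each argument.\<close>

lemma P_mult_assoc:
  assumes f: "f \<in> carrier P" and g: "g \<in> carrier P" and h: "h \<in> carrier P"
  shows "(f \<otimes>\<^bsub>P\<^esub> g) \<otimes>\<^bsub>P\<^esub> h = f \<otimes>\<^bsub>P\<^esub> (g \<otimes>\<^bsub>P\<^esub> h)"
proof
  fix S
  note [simp] = P_carrierD[OF f] P_carrierD[OF g] P_carrierD[OF h]
  show "(f \<otimes>\<^bsub>P\<^esub> g \<otimes>\<^bsub>P\<^esub> h) S = (f \<otimes>\<^bsub>P\<^esub> (g \<otimes>\<^bsub>P\<^esub> h)) S"
  proof (cases "S \<subseteq> V")
    case False
    then show ?thesis by (simp add: P_mult_outside f g h P_mult_closed)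
  next
    case True
    then have fS: "finite S" using finite_V finite_subset by blast
    \<comment> \<open>\<open>F T U W\<close> is the common summand for the blocks \<open>T\<close>,
      \<open>U\<close>, \<open>W\<close>, its sign counting the inversions between every two
      blocks.\<close>
    define F where "F = (\<lambda>T U W. psign (inversions T U + inversions T W + inversions U W)
        \<otimes> (f T \<otimes> (g U \<otimes> h W)))"
    have F[simp]: "F T U W \<in> carrier A" for T U W by (simp add: F_def)
    have "(f \<otimes>\<^bsub>P\<^esub> g \<otimes>\<^bsub>P\<^esub> h) S = (\<Oplus>T\<in>Pow S. \<Oplus>U\<in>Pow T. F U (T - U) (S - T))"
      unfolding P_mult[of "f \<otimes>\<^bsub>P\<^esub> g"]
    proof (rule finsum_cong', rule refl)
      fix T assume T: "T \<in> Pow S"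
      then have fT: "finite T" using fS finite_subset by blast
      have "psign (inversions T (S - T)) \<otimes> ((f \<otimes>\<^bsub>P\<^esub> g) T \<otimes> h (S - T)) =
         (\<Oplus>U\<in>Pow T. psign (inversions T (S - T)) \<otimes>
            (psign (inversions U (T - U)) \<otimes> (f U \<otimes> g (T - U)) \<otimes> h (S - T)))"
        unfolding P_mult using fT by (simp add: finsum_ldistr finsum_rdistr Pi_def)
      also have "\<dots> = (\<Oplus>U\<in>Pow T. F U (T - U) (S - T))"
      proof (rule finsum_cong', rule refl)
        fix U assume U: "U \<in> Pow T"
        have "inversions T (S - T) = inversions U (S - T) + inversions (T - U) (S - T)"
          using inversions_Un_left[of U "T - U" "S - T"] U fT fS
          by (metis Diff_disjoint Diff_partition PowD finite_Diff finite_subset)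
        then show "psign (inversions T (S - T)) \<otimes>
            (psign (inversions U (T - U)) \<otimes> (f U \<otimes> g (T - U)) \<otimes> h (S - T)) = F U (T - U) (S - T)"
          by (simp add: F_def psign_add m_ac)
      qed auto
      finally show "psign (inversions T (S - T)) \<otimes> ((f \<otimes>\<^bsub>P\<^esub> g) T \<otimes> h (S - T)) =
         (\<Oplus>U\<in>Pow T. F U (T - U) (S - T))" .
    qed (auto intro!: finsum_closed)
    also have "\<dots> = (\<Oplus>p\<in>Sigma (Pow S) Pow. (\<lambda>(T, U). F U (T - U) (S - T)) p)"
      using fS by (intro add.finprod_finprod_Sigma) (auto intro: finite_subset)
    \<comment> \<open>The left bracketing chooses the union \<open>T\<close> of the first two blocks
      and then the first block \<open>U\<close> inside it; the map recovers the two blocks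
      themselves.\<close>
    also have "\<dots> = (\<Oplus>p\<in>(\<lambda>(T, U). (U, T - U)) ` Sigma (Pow S) Pow. (\<lambda>(T, U). F T U (S - (T \<union> U))) p)"
    proof (subst finsum_reindex)
      show "inj_on (\<lambda>(T, U). (U, T - U)) (Sigma (Pow S) Pow)"
        by (auto simp: inj_on_def)
    qed (auto intro!: finsum_cong' arg_cong2[of _ _ _ _ "F _"] arg_cong[of _ _ "F _ _"])
    also have "(\<lambda>(T, U). (U, T - U)) ` Sigma (Pow S) Pow = Sigma (Pow S) (\<lambda>T. Pow (S - T))"
    proof -
      have "(T, U) \<in> (\<lambda>(T, U). (U, T - U)) ` Sigma (Pow S) Pow" if "T \<subseteq> S" "U \<subseteq> S - T" for T U
        using that by (intro image_eqI[of _ _ "(T \<union> U, T)"]) auto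
      then show ?thesis by auto
    qed
    also have "(\<Oplus>p\<in>Sigma (Pow S) (\<lambda>T. Pow (S - T)). (\<lambda>(T, U). F T U (S - (T \<union> U))) p)
        = (\<Oplus>T\<in>Pow S. \<Oplus>U\<in>Pow (S - T). F T U (S - (T \<union> U)))"
      using fS by (intro add.finprod_finprod_Sigma[symmetric]) (auto intro: finite_subset)
    also have "\<dots> = (f \<otimes>\<^bsub>P\<^esub> (g \<otimes>\<^bsub>P\<^esub> h)) S"
      unfolding P_mult[of f]
    proof (rule finsum_cong', rule refl)
      fix T assume T: "T \<in> Pow S"
      then have fT: "finite T" using fS finite_subset by blast
      have "psign (inversions T (S - T)) \<otimes> (f T \<otimes> (g \<otimes>\<^bsub>P\<^esub> h) (S - T)) =
         (\<Oplus>U\<in>Pow (S - T). psign (inversions T (S - T)) \<otimes>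
            (f T \<otimes> (psign (inversions U (S - T - U)) \<otimes> (g U \<otimes> h (S - T - U)))))"
        unfolding P_mult using fS by (simp add: finsum_rdistr Pi_def)
      also have "\<dots> = (\<Oplus>U\<in>Pow (S - T). F T U (S - (T \<union> U)))"
      proof (rule finsum_cong', rule refl)
        fix U assume U: "U \<in> Pow (S - T)"
        have "inversions T (S - T) = inversions T U + inversions T (S - T - U)"
          using inversions_Un_right[of T U "S - T - U"] U fT fS
          by (metis Diff_disjoint Diff_partition PowD finite_Diff finite_subset)
        then show "psign (inversions T (S - T)) \<otimes>
            (f T \<otimes> (psign (inversions U (S - T - U)) \<otimes> (g U \<otimes> h (S - T - U)))) = F T U (S - (T \<union> U))"
          by (simp add: F_def psign_add m_ac Diff_Diff_Int Diff_Un Int_Diff set_diff_eq)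
      qed auto
      finally show "(\<Oplus>U\<in>Pow (S - T). F T U (S - (T \<union> U)))
        = psign (inversions T (S - T)) \<otimes> (f T \<otimes> (g \<otimes>\<^bsub>P\<^esub> h) (S - T))" by simp
    qed (auto simp: P_carrierD P_mult_closed g h)
    finally show ?thesis .
  qed
qed

lemma P_mult_zero:
  assumes "f \<in> carrier P" "g \<in> carrier P"
    and "\<And>T. T \<subseteq> S \<Longrightarrow> f T = \<zero> \<or> g (S - T) = \<zero>"
  shows "(f \<otimes>\<^bsub>P\<^esub> g) S = \<zero>"
  unfolding P_mult
proof (rule add.finprod_one_eqI)
  fix T assume "T \<in> Pow S"
  then have "f T = \<zero> \<or> g (S - T) = \<zero>" using assms by blast
  then show "psign (inversions T (S - T)) \<otimes> (f T \<otimes> g (S - T)) = \<zero>"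
    using assms P_carrierD by auto
qed

text \<open>The device for computing coefficients of products: a single splitting of
  \<open>S\<close> survives in the sum over all splittings.\<close>

lemma P_mult_single:
  assumes "f \<in> carrier P" "g \<in> carrier P" "finite S" "U \<subseteq> S"
    and "\<And>T. T \<subseteq> S \<Longrightarrow> T \<noteq> U \<Longrightarrow> f T = \<zero> \<or> g (S - T) = \<zero>"
  shows "(f \<otimes>\<^bsub>P\<^esub> g) S = psign (inversions U (S - U)) \<otimes> (f U \<otimes> g (S - U))"
proof -
  let ?h = "\<lambda>T. psign (inversions T (S - T)) \<otimes> (f T \<otimes> g (S - T))"
  have h: "?h T \<in> carrier A" for T using assms by (simp add: P_carrierD)
  have "finsum A ?h (Pow S) = finsum A ?h {U}"
  proof (rule add.finprod_mono_neutral_cong_right)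
    fix T assume "T \<in> Pow S - {U}"
    then have "f T = \<zero> \<or> g (S - T) = \<zero>" using assms by blast
    then show "?h T = \<zero>" using assms P_carrierD by auto
  qed (use assms h in auto)
  then show ?thesis using h by (simp add: P_mult)
qed

lemma P_one_closed: "\<one>\<^bsub>P\<^esub> \<in> carrier P"
  by (auto simp: P_carrier P_one)

lemma P_l_one: "f \<in> carrier P \<Longrightarrow> \<one>\<^bsub>P\<^esub> \<otimes>\<^bsub>P\<^esub> f = f"
proof
  fix S assume f: "f \<in> carrier P"
  show "(\<one>\<^bsub>P\<^esub> \<otimes>\<^bsub>P\<^esub> f) S = f S"
  proof (cases "S \<subseteq> V")
    case True
    then have "finite S" using finite_V finite_subset by blast
    then show ?thesis
      by (subst P_mult_single[where U = "{}"])
         (use f in \<open>auto simp: P_one P_one_closed P_carrierD psign_def\<close>)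
  qed (simp add: P_mult_outside P_one_closed f P_outside)
qed

lemma P_r_one: "f \<in> carrier P \<Longrightarrow> f \<otimes>\<^bsub>P\<^esub> \<one>\<^bsub>P\<^esub> = f"
proof
  fix S assume f: "f \<in> carrier P"
  show "(f \<otimes>\<^bsub>P\<^esub> \<one>\<^bsub>P\<^esub>) S = f S"
  proof (cases "S \<subseteq> V")
    case True
    then have "finite S" using finite_V finite_subset by blast
    then show ?thesis
      by (subst P_mult_single[where U = S])
         (use f in \<open>auto simp: P_one P_one_closed P_carrierD psign_def\<close>)
  qed (simp add: P_mult_outside P_one_closed f P_outside)
qed

lemma P_l_distr:
  assumes "f \<in> carrier P" "g \<in> carrier P" "h \<in> carrier P"
  shows "(f \<oplus>\<^bsub>P\<^esub> g) \<otimes>\<^bsub>P\<^esub> h = f \<otimes>\<^bsub>P\<^esub> h \<oplus>\<^bsub>P\<^esub> g \<otimes>\<^bsub>P\<^esub> h"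
proof
  fix S
  show "((f \<oplus>\<^bsub>P\<^esub> g) \<otimes>\<^bsub>P\<^esub> h) S = (f \<otimes>\<^bsub>P\<^esub> h \<oplus>\<^bsub>P\<^esub> g \<otimes>\<^bsub>P\<^esub> h) S"
    unfolding P_add[of "f \<otimes>\<^bsub>P\<^esub> h"] P_mult
    by (subst finsum_addf[symmetric])
       (use assms in \<open>auto simp: P_add P_carrierD l_distr r_distr intro!: finsum_cong'\<close>)
qed

lemma P_r_distr:
  assumes "f \<in> carrier P" "g \<in> carrier P" "h \<in> carrier P"
  shows "h \<otimes>\<^bsub>P\<^esub> (f \<oplus>\<^bsub>P\<^esub> g) = h \<otimes>\<^bsub>P\<^esub> f \<oplus>\<^bsub>P\<^esub> h \<otimes>\<^bsub>P\<^esub> g"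
proof
  fix S
  show "(h \<otimes>\<^bsub>P\<^esub> (f \<oplus>\<^bsub>P\<^esub> g)) S = (h \<otimes>\<^bsub>P\<^esub> f \<oplus>\<^bsub>P\<^esub> h \<otimes>\<^bsub>P\<^esub> g) S"
    unfolding P_add[of "h \<otimes>\<^bsub>P\<^esub> f"] P_mult
    by (subst finsum_addf[symmetric])
       (use assms in \<open>auto simp: P_add P_carrierD l_distr r_distr intro!: finsum_cong'\<close>)
qed

lemma ring_P: "ring P"
  by (rule ringI)
     (auto intro!: abelian_group_P monoidI
       simp: P_mult_closed P_one_closed P_mult_assoc P_l_one P_r_one P_l_distr P_r_distr)

interpretation PR: ring P by (rule ring_P)

section \<open>Super-commutativity, odd squares and the grading\<close>

lemma finsum_Pow_complement:
  assumes "\<And>T. T \<subseteq> S \<Longrightarrow> h T \<in> carrier A"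
  shows "(\<Oplus>T\<in>Pow S. h (S - T)) = (\<Oplus>T\<in>Pow S. h T)"
proof -
  have "(\<lambda>T. S - T) ` Pow S = Pow S"
    by (auto simp: image_iff double_diff Bex_def)
  moreover have "inj_on (\<lambda>T. S - T) (Pow S)"
    by (auto simp: inj_on_def)
  ultimately show ?thesis
    using finsum_reindex[of h "\<lambda>T. S - T" "Pow S"] assms by fastforce
qed

text \<open>Unless the term vanishes, \<open>card T\<close> and \<open>card (S - T)\<close> have
  parities \<open>p\<close> and \<open>q\<close>. The two inversion counts add up to the product of
  the cardinalities, which is odd exactly when both parities are odd.\<close>

lemma psign_inversions_swap:
  assumes f: "f \<in> rpart P p" and g: "g \<in> rpart P q" and "finite S" "T \<subseteq> S"
  shows "psign (inversions (S - T) T) \<otimes> (g (S - T) \<otimes> f T)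
    = psign (if p \<and> q then 1 else 0) \<otimes> (psign (inversions T (S - T)) \<otimes> (f T \<otimes> g (S - T)))"
proof -
  have c: "f T \<in> carrier A" "g (S - T) \<in> carrier A"
    using f g by (auto simp: P_rpart P_carrierD)
  consider "f T = \<zero> \<or> g (S - T) = \<zero>" | "odd (card T) = p" "odd (card (S - T)) = q"
    using f g by (auto simp: P_rpart)
  then show ?thesis
  proof cases
    case 1
    then show ?thesis using c by auto
  next
    case 2
    have "finite T" using assms finite_subset by blast
    then have "inversions T (S - T) + inversions (S - T) T = card T * card (S - T)"
      using assms by (intro inversions_swap) auto
    then have "odd (inversions T (S - T)) \<noteq> odd (inversions (S - T) T) \<longleftrightarrow> p \<and> q"
      using 2 by (metis even_add even_mult_iff)
    then show ?thesis
      using c by (auto simp: psign_def l_minus r_minus m_comm split: if_splits)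
  qed
qed

lemma P_super_comm:
  assumes f: "f \<in> rpart P p" and g: "g \<in> rpart P q"
  shows "f \<otimes>\<^bsub>P\<^esub> g = (if p \<and> q then \<ominus>\<^bsub>P\<^esub> (g \<otimes>\<^bsub>P\<^esub> f) else g \<otimes>\<^bsub>P\<^esub> f)"
proof -
  have fc: "f \<in> carrier P" and gc: "g \<in> carrier P" using f g by (auto simp: P_rpart)
  have "(g \<otimes>\<^bsub>P\<^esub> f) S = psign (if p \<and> q then 1 else 0) \<otimes> (f \<otimes>\<^bsub>P\<^esub> g) S" for S
  proof (cases "S \<subseteq> V")
    case False
    then show ?thesis by (simp add: P_mult_outside fc gc)
  next
    case True
    then have fS: "finite S" using finite_V finite_subset by blast
    let ?h = "\<lambda>T. psign (inversions T (S - T)) \<otimes> (g T \<otimes> f (S - T))"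
    have "(g \<otimes>\<^bsub>P\<^esub> f) S = (\<Oplus>T\<in>Pow S. ?h (S - T))"
      unfolding P_mult using fc gc by (intro finsum_Pow_complement[symmetric]) (simp add: P_carrierD)
    also have "\<dots> = (\<Oplus>T\<in>Pow S. psign (if p \<and> q then 1 else 0)
          \<otimes> (psign (inversions T (S - T)) \<otimes> (f T \<otimes> g (S - T))))"
    proof (intro finsum_cong' refl)
      fix T assume "T \<in> Pow S"
      then show "?h (S - T) = psign (if p \<and> q then 1 else 0)
          \<otimes> (psign (inversions T (S - T)) \<otimes> (f T \<otimes> g (S - T)))"
        using psign_inversions_swap[OF f g fS, of T] by (simp add: double_diff)
    qed (use fc gc in \<open>auto simp: P_carrierD\<close>)
    also have "\<dots> = psign (if p \<and> q then 1 else 0) \<otimes> (f \<otimes>\<^bsub>P\<^esub> g) S"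
      unfolding P_mult using fS fc gc by (subst finsum_rdistr) (auto simp: P_carrierD)
    finally show ?thesis .
  qed
  then show ?thesis
    using fc gc by (auto simp: fun_eq_iff psign_def P_uminus P_mult_closed P_carrierD l_minus)
qed

text \<open>Super-commutativity only makes the square equal to its own negative, which says nothing
  in characteristic two. Instead the summands for \<open>T\<close> and \<open>S - T\<close> cancel
  in pairs.\<close>

lemma P_odd_square:
  assumes f: "f \<in> rpart P True"
  shows "f \<otimes>\<^bsub>P\<^esub> f = \<zero>\<^bsub>P\<^esub>"
proof
  fix S
  have fc: "f \<in> carrier P" using f by (auto simp: P_rpart)
  show "(f \<otimes>\<^bsub>P\<^esub> f) S = \<zero>\<^bsub>P\<^esub> S"
  proof (cases "S \<subseteq> V \<and> S \<noteq> {}")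
    case False
    then consider "\<not> S \<subseteq> V" | "S = {}" by blast
    then show ?thesis
    proof cases
      case 2
      \<comment> \<open>The empty set has even cardinality, so an odd \<open>f\<close> has no
        constant term.\<close>
      have "f {} = \<zero>" using f by (auto simp: P_rpart)
      then show ?thesis using fc 2 by (auto simp: P_zero intro!: P_mult_zero)
    qed (simp add: P_mult_outside fc P_zero)
  next
    case True
    then have fS: "finite S" using finite_V finite_subset by blast
    \<comment> \<open>The element \<open>m\<close> selects from each complementary pair the set
      containing it, so every pair is counted once.\<close>
    obtain m where m: "m \<in> S" using True by blast
    let ?h = "\<lambda>T. psign (inversions T (S - T)) \<otimes> (f T \<otimes> f (S - T))"
    let ?B = "{T \<in> Pow S. m \<in> T}"
    have h: "?h T \<in> carrier A" for T using fc by (simp add: P_carrierD)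
    have "Pow S = ?B \<union> (\<lambda>T. S - T) ` ?B"
    proof -
      have "T \<in> (\<lambda>T. S - T) ` ?B" if "T \<subseteq> S" "m \<notin> T" for T
        using that m by (intro image_eqI[of _ _ "S - T"]) auto
      then show ?thesis by auto
    qed
    then have "(f \<otimes>\<^bsub>P\<^esub> f) S = finsum A ?h (?B \<union> (\<lambda>T. S - T) ` ?B)"
      unfolding P_mult by (rule arg_cong)
    also have "\<dots> = finsum A ?h ?B \<oplus> finsum A ?h ((\<lambda>T. S - T) ` ?B)"
      using fS h by (intro finsum_Un_disjoint) auto
    also have "finsum A ?h ((\<lambda>T. S - T) ` ?B) = (\<Oplus>T\<in>?B. ?h (S - T))"
      using h by (subst finsum_reindex) (auto simp: inj_on_def)
    also have "finsum A ?h ?B \<oplus> \<dots> = (\<Oplus>T\<in>?B. ?h T \<oplus> ?h (S - T))"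
      using h by (subst finsum_addf) auto
    also have "\<dots> = \<zero>"
    proof (rule add.finprod_one_eqI)
      fix T assume "T \<in> ?B"
      then have "?h (S - T) = \<ominus> ?h T"
        using psign_inversions_swap[OF f f fS, of T] h[of T] fc
        by (simp add: double_diff psign_def[of "Suc 0"] l_minus)
      then show "?h T \<oplus> ?h (S - T) = \<zero>" using h[of T] by (simp add: r_neg)
    qed
    finally show ?thesis by (simp add: P_zero)
  qed
qed

lemma P_mult_part:
  assumes f: "f \<in> rpart P p" and g: "g \<in> rpart P q"
  shows "f \<otimes>\<^bsub>P\<^esub> g \<in> rpart P (p \<noteq> q)"
proof -
  have fc: "f \<in> carrier P" and gc: "g \<in> carrier P" using f g by (auto simp: P_rpart)
  have "odd (card S) = (p \<noteq> q)" if nz: "(f \<otimes>\<^bsub>P\<^esub> g) S \<noteq> \<zero>" for S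
  proof -
    have "S \<subseteq> V" using nz P_mult_outside[OF fc gc] by blast
    then have fS: "finite S" using finite_V finite_subset by blast
    obtain T where T: "T \<subseteq> S" "f T \<noteq> \<zero>" "g (S - T) \<noteq> \<zero>"
      using nz P_mult_zero[OF fc gc] by blast
    then have "card S = card T + card (S - T)"
      using fS by (metis card_Diff_subset card_mono finite_subset le_add_diff_inverse)
    then show ?thesis using T f g by (auto simp: P_rpart)
  qed
  then show ?thesis using fc gc by (simp add: P_rpart P_mult_closed)
qed

lemma P_grading: "Z2_grading P (rpart P)"
  unfolding Z2_grading_def
proof (intro conjI allI)
  fix p
  have "subgroup (rpart P p) (add_monoid P)"
  proof (rule group.subgroupI[OF abelian_group.a_group[OF abelian_group_P]])
    show "rpart P p \<noteq> {}"
      by (rule ex_in_conv[THEN iffD1], rule exI[of _ "\<zero>\<^bsub>P\<^esub>"]) (simp add: P_rpart P_zero)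
    show "rpart P p \<subseteq> carrier (add_monoid P)" by (auto simp: P_rpart)
    show "inv\<^bsub>add_monoid P\<^esub> f \<in> rpart P p" if "f \<in> rpart P p" for f
      using that by (auto simp: P_rpart P_uminus P_carrierD simp flip: a_inv_def)
    show "f \<otimes>\<^bsub>add_monoid P\<^esub> g \<in> rpart P p" if fg: "f \<in> rpart P p" "g \<in> rpart P p" for f g
    proof -
      have "f S \<noteq> \<zero> \<or> g S \<noteq> \<zero>" if "f S \<oplus> g S \<noteq> \<zero>" for S using that by auto
      then show ?thesis using fg by (auto simp: P_rpart P_add P_add_closed)
    qed
  qed
  then show "additive_subgroup (rpart P p) P"
    by (rule additive_subgroup.intro)
next
  show "carrier P = rpart P False <+>\<^bsub>P\<^esub> rpart P True"
  proof
    show "carrier P \<subseteq> rpart P False <+>\<^bsub>P\<^esub> rpart P True"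
    proof
      fix f assume f: "f \<in> carrier P"
      define g where "g = (\<lambda>p S. if odd (card S) = p then f S else \<zero>)"
      have "g p \<in> rpart P p" for p
        using f unfolding g_def P_rpart P_carrier by auto
      moreover have "f = g False \<oplus>\<^bsub>P\<^esub> g True"
        unfolding g_def fun_eq_iff P_add using P_carrierD[OF f] by auto
      ultimately show "f \<in> rpart P False <+>\<^bsub>P\<^esub> rpart P True"
        unfolding set_add_def set_mult_def by force
    qed
    show "rpart P False <+>\<^bsub>P\<^esub> rpart P True \<subseteq> carrier P"
      unfolding set_add_def set_mult_def by (auto simp: P_rpart P_add_closed)
  qed
next
  show "rpart P False \<inter> rpart P True = {\<zero>\<^bsub>P\<^esub>}"
    by (auto simp: P_rpart P_zero fun_eq_iff)
qed

theorem super_ring_P: "super_ring P"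
  by (intro super_ring.intro super_ring_axioms.intro ring_P P_grading)
     (fact P_mult_part P_super_comm P_odd_square)+

end

section \<open>Zero-dimensional rings\<close>

lemma (in primeideal) nat_pow_mem:
  fixes n :: nat
  shows "x \<in> carrier R \<Longrightarrow> x [^] n \<in> I \<Longrightarrow> x \<in> I"
proof (induction n)
  case 0
  then show ?case using one_imp_carrier by auto
next
  case (Suc n)
  then show ?case using I_prime[of "x [^] n" x] by auto
qed

text \<open>A maximal element among the ideals missing \<open>\<one>\<close>, given by Zorn's lemma,
  is a maximal and hence prime ideal. It supplies the chain of length zero, without which the
  supremum in \<open>Kdim\<close> would be \<open>-\<infinity>\<close>.\<close>

lemma (in cring) ex_primeideal:
  assumes "\<one> \<noteq> \<zero>"
  shows "\<exists>I. primeideal I R"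
proof -
  let ?S = "{I. ideal I R \<and> \<one> \<notin> I}"
  have "\<exists>M\<in>?S. \<forall>X\<in>?S. M \<subseteq> X \<longrightarrow> X = M"
  proof (rule subset_Zorn_nonempty)
    show "?S \<noteq> {}" using zeroideal assms by blast
  next
    fix C assume C: "C \<noteq> {}" "subset.chain ?S C"
    then have "subset.chain {I. ideal I R} C" by (auto simp: subset.chain_def)
    then have "ideal (if C = {} then {\<zero>} else \<Union>C) R" by (rule chain_Union_is_ideal)
    then show "\<Union>C \<in> ?S" using C by (auto simp: subset.chain_def)
  qed
  then obtain M where M: "ideal M R" "\<one> \<notin> M"
    "\<And>X. ideal X R \<Longrightarrow> \<one> \<notin> X \<Longrightarrow> M \<subseteq> X \<Longrightarrow> X = M" by blast
  have "maximalideal M R"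
  proof (rule maximalidealI)
    show "carrier R \<noteq> M" using M(2) by auto
    fix J assume "ideal J R" "M \<subseteq> J" "J \<subseteq> carrier R"
    then show "J = M \<or> J = carrier R" using M(3) ideal.one_imp_carrier by blast
  qed fact
  then show ?thesis using maximalideal_prime by blast
qed

text \<open>The hypothesis says that modulo nilpotents every element is strongly \<open>\<pi>\<close>-regular. An element
  of \<open>P 1 - P 0\<close> would then yield \<open>a \<notin> P 0\<close> with \<open>a\<^sup>k (1 - a b) = 0\<close>, so
  \<open>1 - a b \<in> P 0 \<subseteq> P 1\<close> and hence \<open>1 \<in> P 1\<close>.\<close>

lemma (in cring) Kdim_eq_0:
  assumes "\<one> \<noteq> \<zero>"
    and reg: "\<And>x. x \<in> carrier R \<Longrightarrow> \<exists>a\<in>carrier R. \<exists>b\<in>carrier R. \<exists>(n::nat) k::nat.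
      (x \<ominus> a) [^] n = \<zero> \<and> a [^] k \<otimes> (\<one> \<ominus> a \<otimes> b) = \<zero>"
  shows "Kdim R = 0"
proof -
  have no_chain: "P = Q" if P: "primeideal P R" and Q: "primeideal Q R" and "P \<subseteq> Q" for P Q
  proof (rule ccontr)
    interpret P: primeideal P R by fact
    interpret Q: primeideal Q R by fact
    assume "P \<noteq> Q"
    then obtain x where x: "x \<in> Q" "x \<notin> P" using \<open>P \<subseteq> Q\<close> by blast
    then have xc: "x \<in> carrier R" using Q.Icarr by blast
    obtain a b and n k :: nat where ab: "a \<in> carrier R" "b \<in> carrier R"
      "(x \<ominus> a) [^] n = \<zero>" "a [^] k \<otimes> (\<one> \<ominus> a \<otimes> b) = \<zero>"
      using reg[OF xc] by blast
    have xa: "x \<ominus> a \<in> P"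
      using P.nat_pow_mem[of "x \<ominus> a" n] ab xc by auto
    have "a = x \<oplus> \<ominus> (x \<ominus> a)" using ab xc by algebra
    then have aQ: "a \<in> Q"
      using x xa \<open>P \<subseteq> Q\<close> by (metis Q.a_closed Q.a_inv_closed subsetD)
    have "a \<notin> P"
    proof
      assume "a \<in> P"
      then have "(x \<ominus> a) \<oplus> a \<in> P" using xa by simp
      moreover have "(x \<ominus> a) \<oplus> a = x" using ab xc by algebra
      ultimately show False using x by simp
    qed
    then have "\<one> \<ominus> a \<otimes> b \<in> P"
      using P.I_prime[of "a [^] k" "\<one> \<ominus> a \<otimes> b"] P.nat_pow_mem[of a k] ab by auto
    then have "(\<one> \<ominus> a \<otimes> b) \<oplus> a \<otimes> b \<in> Q"
      using aQ ab \<open>P \<subseteq> Q\<close> by (auto simp: Q.I_r_closed)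
    moreover have "(\<one> \<ominus> a \<otimes> b) \<oplus> a \<otimes> b = \<one>" using ab by algebra
    ultimately show False using Q.one_imp_carrier Q.I_notcarr by auto
  qed
  have "{ereal (real n) | n. \<exists>P. (\<forall>i\<le>n. primeideal (P i) R) \<and> (\<forall>i<n. P i \<subset> P (Suc i))} = {0}"
    (is "?L = _")
  proof
    show "?L \<subseteq> {0}"
    proof clarify
      fix n :: nat and P :: "nat \<Rightarrow> 'a set"
      assume P: "\<forall>i\<le>n. primeideal (P i) R" "\<forall>i<n. P i \<subset> P (Suc i)"
      have "n = 0"
      proof (rule ccontr)
        assume "n \<noteq> 0"
        then have "primeideal (P 0) R" "primeideal (P (Suc 0)) R" "P 0 \<subset> P (Suc 0)" using P by auto
        then show False using no_chain by blast
      qed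
      then show "ereal (real n) = 0" by simp
    qed
    obtain I where "primeideal I R" using ex_primeideal assms by blast
    then have "\<exists>P. (\<forall>i\<le>0::nat. primeideal (P i) R) \<and> (\<forall>i<0. P i \<subset> P (Suc i))"
      by (intro exI[of _ "\<lambda>_. I"]) auto
    then show "{0} \<subseteq> ?L" by (auto intro!: exI[of _ 0])
  qed
  then show ?thesis by (simp add: Kdim_def)
qed

text \<open>The regularity condition consists of ring equations, so it passes along the projection;
  that \<open>\<one>\<close> lies outside \<open>I\<close> keeps the quotient nonzero.\<close>

lemma (in cring) Kdim_Quot_eq_0:
  assumes I: "ideal I R" and "\<one> \<notin> I"
    and reg: "\<And>x. x \<in> carrier R \<Longrightarrow> \<exists>a\<in>carrier R. \<exists>b\<in>carrier R. \<exists>(n::nat) k::nat.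
      (x \<ominus> a) [^] n = \<zero> \<and> a [^] k \<otimes> (\<one> \<ominus> a \<otimes> b) = \<zero>"
  shows "Kdim (R Quot I) = 0"
proof -
  interpret I: ideal I R by fact
  have "I +> \<one> \<noteq> I" using I.a_rcos_self[OF one_closed] assms(2) by auto
  then have one_zero: "\<one>\<^bsub>R Quot I\<^esub> \<noteq> \<zero>\<^bsub>R Quot I\<^esub>" by (simp add: FactRing_def)
  interpret h: ring_hom_cring R "R Quot I" "(+>) I"
    by (rule I.rcos_ring_hom_cring) (rule is_cring)
  show ?thesis
  proof (rule h.S.Kdim_eq_0)
    show "\<one>\<^bsub>R Quot I\<^esub> \<noteq> \<zero>\<^bsub>R Quot I\<^esub>" by (rule one_zero)
  next
    fix y assume "y \<in> carrier (R Quot I)"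
    then obtain x where x: "x \<in> carrier R" "y = I +> x"
      unfolding FactRing_def A_RCOSETS_def' by auto
    obtain a b and n k :: nat where ab: "a \<in> carrier R" "b \<in> carrier R"
      "(x \<ominus> a) [^] n = \<zero>" "a [^] k \<otimes> (\<one> \<ominus> a \<otimes> b) = \<zero>"
      using reg[OF x(1)] by blast
    have "y \<ominus>\<^bsub>R Quot I\<^esub> (I +> a) = I +> (x \<ominus> a)"
      using x ab by (simp add: a_minus_def)
    then have "(y \<ominus>\<^bsub>R Quot I\<^esub> (I +> a)) [^]\<^bsub>R Quot I\<^esub> n = I +> ((x \<ominus> a) [^] n)"
      using ring_hom_ring.hom_nat_pow[OF I.rcos_ring_hom_ring, of "x \<ominus> a" n] x ab(1) by simp
    moreover have "(I +> a) [^]\<^bsub>R Quot I\<^esub> k \<otimes>\<^bsub>R Quot I\<^esub> (\<one>\<^bsub>R Quot I\<^esub> \<ominus>\<^bsub>R Quot I\<^esub> (I +> a) \<otimes>\<^bsub>R Quot I\<^esub> (I +> b))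
        = I +> (a [^] k \<otimes> (\<one> \<ominus> a \<otimes> b))"
      using x(1) ab(1,2) by (simp add: ring_hom_ring.hom_nat_pow[OF I.rcos_ring_hom_ring] a_minus_def)
    ultimately show "\<exists>a\<in>carrier (R Quot I). \<exists>b\<in>carrier (R Quot I). \<exists>(n::nat) k::nat.
        (y \<ominus>\<^bsub>R Quot I\<^esub> a) [^]\<^bsub>R Quot I\<^esub> n = \<zero>\<^bsub>R Quot I\<^esub> \<and>
        a [^]\<^bsub>R Quot I\<^esub> k \<otimes>\<^bsub>R Quot I\<^esub> (\<one>\<^bsub>R Quot I\<^esub> \<ominus>\<^bsub>R Quot I\<^esub> a \<otimes>\<^bsub>R Quot I\<^esub> b) = \<zero>\<^bsub>R Quot I\<^esub>"
      using ab(1,2) unfolding ab(3,4) h.hom_zero by (intro bexI[of _ "I +> a"] bexI[of _ "I +> b"]) auto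
  qed
qed

text \<open>The descending chain of ideals generated by the powers of \<open>a\<close> stabilises at
  some \<open>N\<close>, and \<open>a^N = c a^(N+1)\<close> rearranges to the claim with
  \<open>b = c\<close> and \<open>k = N\<close>.\<close>

lemma (in artinian_cring) strongly_pi_regular:
  assumes "a \<in> carrier R"
  shows "\<exists>b\<in>carrier R. \<exists>k::nat. a [^] k \<otimes> (\<one> \<ominus> a \<otimes> b) = \<zero>"
proof -
  let ?I = "\<lambda>n::nat. PIdl (a [^] n)"
  have "\<exists>N. \<forall>n\<ge>N. ?I n = ?I N"
  proof (rule descending_chain)
    show "ideal (?I n) R" for n using assms by (intro cgenideal_ideal) simp
    show "?I (Suc n) \<subseteq> ?I n" for n
    proof
      fix y assume "y \<in> ?I (Suc n)"
      then obtain c where "c \<in> carrier R" "y = c \<otimes> (a [^] n \<otimes> a)" by (auto simp: cgenideal_def)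
      then have "y = (c \<otimes> a) \<otimes> a [^] n" "c \<otimes> a \<in> carrier R" using assms by (auto simp: m_ac)
      then show "y \<in> ?I n" by (auto simp: cgenideal_def)
    qed
  qed
  then obtain N where "?I (Suc N) = ?I N" by (metis le_SucI order_refl)
  then have "a [^] N \<in> ?I (Suc N)" using assms cgenideal_self by simp
  then obtain c where c: "c \<in> carrier R" "a [^] N = c \<otimes> (a [^] N \<otimes> a)" by (auto simp: cgenideal_def)
  have "a [^] N \<otimes> (\<one> \<ominus> a \<otimes> c) = a [^] N \<ominus> c \<otimes> (a [^] N \<otimes> a)"
    using assms c(1) nat_pow_closed[OF assms, of N] by algebra
  also have "\<dots> = \<zero>" using c assms by (simp add: r_right_minus_eq flip: c(2))
  finally show ?thesis using c by blast
qed

section \<open>The even part of a super-ring\<close>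

text \<open>The grading axioms do not mention \<open>\<one>\<close>, so the main point is that it is
  even: its odd component is shown to vanish by means of \<open>odd_square\<close>.\<close>

lemma (in super_ring) cring_even_ring: "cring (even_ring R)"
proof -
  interpret E: additive_subgroup "rpart R False" R
    using grading by (simp add: Z2_grading_def)
  have one: "\<one> \<in> rpart R False"
  proof -
    have "\<one> \<in> rpart R False <+> rpart R True"
      using grading one_closed by (auto simp: Z2_grading_def)
    then obtain a b where ab: "a \<in> rpart R False" "b \<in> rpart R True" "\<one> = a \<oplus> b"
      by (auto simp: set_add_defs)
    interpret O: additive_subgroup "rpart R True" R
      using grading by (simp add: Z2_grading_def)
    have c: "a \<in> carrier R" "b \<in> carrier R" using ab by auto
    \<comment> \<open>Multiplying \<open>\<one> = a \<oplus> b\<close> by \<open>a\<close> exhibits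
      the odd element \<open>b \<otimes> a\<close> as \<open>a\<close> minus
      \<open>a \<otimes> a\<close>, which is even, so it vanishes. Multiplying \<open>b\<close> by
      the same sum then leaves \<open>b = b \<otimes> b\<close>, which is zero.\<close>
    have "a = a \<otimes> a \<oplus> b \<otimes> a" using l_distr[of a b a] l_one[of a] ab c by simp
    moreover have "b \<otimes> a \<in> rpart R True" "a \<otimes> a \<in> rpart R False"
      using mult_part[OF ab(2,1)] mult_part[OF ab(1,1)] by auto
    moreover have "b \<otimes> a = (a \<otimes> a \<oplus> b \<otimes> a) \<oplus> \<ominus> (a \<otimes> a)"
      using c by algebra
    ultimately have "b \<otimes> a \<in> rpart R False \<inter> rpart R True"
      using ab E.a_closed E.a_inv_closed by (metis IntI)
    then have "b \<otimes> a = \<zero>" using grading by (auto simp: Z2_grading_def)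
    moreover have "b = b \<otimes> a \<oplus> b \<otimes> b" using r_distr[of a b b] r_one[of b] ab c by simp
    ultimately have "b = \<zero>" using odd_square[OF ab(2)] by simp
    then show ?thesis using ab c by simp
  qed
  have "comm_monoid (even_ring R)"
  proof (rule comm_monoidI)
    fix x y assume "x \<in> carrier (even_ring R)" "y \<in> carrier (even_ring R)"
    then have "x \<in> rpart R False" "y \<in> rpart R False" by (simp_all add: even_ring_def)
    then show "x \<otimes>\<^bsub>even_ring R\<^esub> y \<in> carrier (even_ring R)"
      and "x \<otimes>\<^bsub>even_ring R\<^esub> y = y \<otimes>\<^bsub>even_ring R\<^esub> x"
      using mult_part[of x False y False] super_comm[of x False y False]
      by (simp_all add: even_ring_def)
  qed (use one in \<open>auto simp: even_ring_def m_assoc\<close>)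
  moreover have "abelian_group (even_ring R)"
  proof (rule abelian_groupI)
    fix x assume "x \<in> carrier (even_ring R)"
    then show "\<exists>y\<in>carrier (even_ring R). y \<oplus>\<^bsub>even_ring R\<^esub> x = \<zero>\<^bsub>even_ring R\<^esub>"
      by (intro bexI[of _ "\<ominus> x"]) (auto simp: even_ring_def l_neg)
  qed (auto simp: even_ring_def a_ac)
  ultimately show ?thesis
    by (intro cringI) (auto simp: even_ring_def l_distr)
qed

section \<open>Odd parameters over an Artinian base ring\<close>

context exterior_algebra
begin

interpretation PS: super_ring P by (rule super_ring_P)

lemma even_ring_const_mult:
  assumes "a \<in> carrier A" "b \<in> carrier A"
  shows "(\<lambda>S. if S = {} then a else \<zero>) \<otimes>\<^bsub>P\<^esub> (\<lambda>S. if S = {} then b else \<zero>)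
    = (\<lambda>S. if S = {} then a \<otimes> b else \<zero>)" (is "?c a \<otimes>\<^bsub>P\<^esub> ?c b = _")
proof
  fix S
  have c: "?c a \<in> carrier P" "?c b \<in> carrier P" using assms by (auto simp: P_carrier)
  show "(?c a \<otimes>\<^bsub>P\<^esub> ?c b) S = ?c (a \<otimes> b) S"
  proof (cases "S = {}")
    case True
    then show ?thesis using assms
      by (subst P_mult_single[OF c, where U = "{}"]) (auto simp: psign_def)
  next
    case False
    then have "(?c a \<otimes>\<^bsub>P\<^esub> ?c b) S = \<zero>"
      by (intro P_mult_zero[OF c]) (metis Diff_empty)
    then show ?thesis using False by simp
  qed
qed

text \<open>Constants embed \<open>A\<close> into the even part, so that equations in
  \<open>A\<close> such as strong \<pi>-regularity can be moved there.\<close>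

lemma even_ring_const_hom: "(\<lambda>a S. if S = {} then a else \<zero>) \<in> ring_hom A (even_ring P)"
  by (rule ring_hom_memI)
     (auto simp: even_ring_def P_rpart P_carrier P_add P_one even_ring_const_mult fun_eq_iff)

text \<open>Without a constant term each further factor enlarges the monomials by at least one
  generator, so the \<open>n\<close>-th power lives on sets of at least \<open>n\<close> elements,
  whereas \<open>V\<close> has only \<open>card V\<close>.\<close>

lemma even_ring_nilpotent:
  assumes x: "x \<in> carrier (even_ring P)" and "x {} = \<zero>"
  shows "x [^]\<^bsub>even_ring P\<^esub> Suc (card V) = \<zero>\<^bsub>even_ring P\<^esub>"
proof -
  interpret E: cring "even_ring P" by (rule PS.cring_even_ring)
  have carr: "f \<in> carrier P" if "f \<in> carrier (even_ring P)" for f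
    using that by (simp add: even_ring_def P_rpart)
  have mult: "f \<otimes>\<^bsub>even_ring P\<^esub> g = f \<otimes>\<^bsub>P\<^esub> g" for f g by (simp add: even_ring_def)
  have "n \<le> card S" if "(x [^]\<^bsub>even_ring P\<^esub> n) S \<noteq> \<zero>" for n S
    using that
  proof (induction n arbitrary: S)
    case (Suc n)
    let ?f = "x [^]\<^bsub>even_ring P\<^esub> n"
    have f: "?f \<in> carrier P" "x \<in> carrier P" using x carr by auto
    have nz: "(?f \<otimes>\<^bsub>P\<^esub> x) S \<noteq> \<zero>" using Suc.prems by (simp add: mult)
    then obtain T where T: "T \<subseteq> S" "?f T \<noteq> \<zero>" "x (S - T) \<noteq> \<zero>"
      using P_mult_zero[OF f] by blast
    have "S \<subseteq> V" using nz P_mult_outside[OF f] by blast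
    then have "finite S" using finite_V finite_subset by blast
    moreover have "T \<subset> S" using T assms(2) by (metis Diff_cancel psubsetI)
    ultimately show ?case using Suc.IH[OF T(2)] psubset_card_mono[of S T] by linarith
  qed simp
  moreover have "card S \<le> card V" if "S \<subseteq> V" for S using that finite_V card_mono by blast
  moreover have "x [^]\<^bsub>even_ring P\<^esub> n \<in> carrier P" for n :: nat using x carr by auto
  ultimately have "(x [^]\<^bsub>even_ring P\<^esub> Suc (card V)) S = \<zero>" for S
    by (metis P_outside Suc_n_not_le_n order_trans)
  then show ?thesis by (auto simp: even_ring_def P_zero fun_eq_iff)
qed

text \<open>Take for \<open>a\<close> the constant term of \<open>x\<close>: the difference is
  nilpotent, and strong \<pi>-regularity of \<open>A\<close> supplies \<open>b\<close>. This is the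
  hypothesis of \<open>Kdim_Quot_eq_0\<close> for the even part.\<close>

lemma even_ring_regular_mod_nilpotent:
  assumes "artinian_cring A" and x: "x \<in> carrier (even_ring P)"
  shows "\<exists>a\<in>carrier (even_ring P). \<exists>b\<in>carrier (even_ring P). \<exists>(n::nat) k::nat.
    (x \<ominus>\<^bsub>even_ring P\<^esub> a) [^]\<^bsub>even_ring P\<^esub> n = \<zero>\<^bsub>even_ring P\<^esub> \<and>
    a [^]\<^bsub>even_ring P\<^esub> k \<otimes>\<^bsub>even_ring P\<^esub> (\<one>\<^bsub>even_ring P\<^esub> \<ominus>\<^bsub>even_ring P\<^esub> a \<otimes>\<^bsub>even_ring P\<^esub> b)
      = \<zero>\<^bsub>even_ring P\<^esub>"
proof -
  interpret E: cring "even_ring P" by (rule PS.cring_even_ring)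
  define c where "c = (\<lambda>a (S :: nat set). if S = {} then a else \<zero>)"
  interpret c: ring_hom_ring A "even_ring P" c
    unfolding c_def by (rule ring_hom_ringI2[OF ring_axioms E.ring_axioms even_ring_const_hom])
  have xc: "x \<in> carrier P" using x by (simp add: even_ring_def P_rpart)
  obtain b and k :: nat where b: "b \<in> carrier A" "x {} [^] k \<otimes> (\<one> \<ominus> x {} \<otimes> b) = \<zero>"
    using artinian_cring.strongly_pi_regular[OF assms(1) P_carrierD[OF xc]] by blast
  have x0: "x {} \<in> carrier A" using xc by (rule P_carrierD)
  define y where "y = x \<ominus>\<^bsub>even_ring P\<^esub> c (x {})"
  have y: "y \<in> carrier (even_ring P)" using x x0 by (simp add: y_def)
  have "y \<oplus>\<^bsub>even_ring P\<^esub> c (x {}) = x"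
    using x c.hom_closed[OF x0] unfolding y_def by algebra
  then have "y {} \<oplus> x {} = x {}"
    by (auto simp: even_ring_def P_add c_def fun_eq_iff dest: spec[of _ "{}"])
  moreover have "y {} \<in> carrier A"
    using y by (simp add: even_ring_def P_rpart P_carrierD)
  ultimately have "y {} = \<zero>" using x0 by simp
  then have "y [^]\<^bsub>even_ring P\<^esub> Suc (card V) = \<zero>\<^bsub>even_ring P\<^esub>"
    using even_ring_nilpotent y by blast
  moreover have "c (x {}) [^]\<^bsub>even_ring P\<^esub> k \<otimes>\<^bsub>even_ring P\<^esub> (\<one>\<^bsub>even_ring P\<^esub> \<ominus>\<^bsub>even_ring P\<^esub> c (x {}) \<otimes>\<^bsub>even_ring P\<^esub> c b)
      = c (x {} [^] k \<otimes> (\<one> \<ominus> x {} \<otimes> b))"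
    using b(1) x0 by (simp add: c.hom_nat_pow a_minus_def)
  ultimately show ?thesis
    using c.hom_closed[OF x0] c.hom_closed[OF b(1)] unfolding b(2) c.hom_zero y_def by blast
qed

end

section \<open>Annihilators, images and quotients of supermodules\<close>

context supermodule
begin

lemma smult_l_null: "x \<in> carrier M \<Longrightarrow> \<zero> \<odot>\<^bsub>M\<^esub> x = \<zero>\<^bsub>M\<^esub>"
  using smult_l_distr[of \<zero> \<zero> x] smult_closed[of \<zero> x]
  by (metis R.l_zero R.zero_closed M.add.r_cancel_one')

lemma smult_r_null: "a \<in> carrier R \<Longrightarrow> a \<odot>\<^bsub>M\<^esub> \<zero>\<^bsub>M\<^esub> = \<zero>\<^bsub>M\<^esub>"
  using smult_r_distr[of a "\<zero>\<^bsub>M\<^esub>" "\<zero>\<^bsub>M\<^esub>"] smult_closed[of a "\<zero>\<^bsub>M\<^esub>"]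
  by (metis M.l_zero M.zero_closed M.add.r_cancel_one')

lemma smult_l_minus: "a \<in> carrier R \<Longrightarrow> x \<in> carrier M \<Longrightarrow> (\<ominus> a) \<odot>\<^bsub>M\<^esub> x = \<ominus>\<^bsub>M\<^esub> (a \<odot>\<^bsub>M\<^esub> x)"
  using smult_l_distr[of "\<ominus> a" a x] smult_closed[of a x] smult_closed[of "\<ominus> a" x]
  by (metis M.minus_equality R.a_inv_closed R.l_neg smult_l_null)

lemma smult_r_minus: "a \<in> carrier R \<Longrightarrow> x \<in> carrier M \<Longrightarrow> a \<odot>\<^bsub>M\<^esub> (\<ominus>\<^bsub>M\<^esub> x) = \<ominus>\<^bsub>M\<^esub> (a \<odot>\<^bsub>M\<^esub> x)"
  using smult_r_distr[of a "\<ominus>\<^bsub>M\<^esub> x" x] smult_closed[of a x] smult_closed[of a "\<ominus>\<^bsub>M\<^esub> x"]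
  by (metis M.minus_equality M.a_inv_closed M.l_neg smult_r_null)

lemma rpart_carrier: "a \<in> rpart R p \<Longrightarrow> a \<in> carrier R"
  using R.grading by (auto simp: Z2_grading_def dest: additive_subgroup.a_Hcarr)

text \<open>Regarding the elements of \<open>K\<close> as zero lets one statement serve both
  submodules, with \<open>K\<close> trivial, and quotients by \<open>K\<close>.\<close>

lemma ideal_annihilator:
  assumes K: "additive_subgroup K M" and X: "X \<subseteq> carrier M"
    and closed: "\<And>r k. r \<in> rpart R False \<Longrightarrow> k \<in> K \<Longrightarrow> r \<odot>\<^bsub>M\<^esub> k \<in> K"
  shows "ideal {r \<in> rpart R False. \<forall>x\<in>X. r \<odot>\<^bsub>M\<^esub> x \<in> K} (even_ring R)" (is "ideal ?I _")
proof -
  interpret K: additive_subgroup K M by fact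
  interpret E: cring "even_ring R" by (rule R.cring_even_ring)
  have X': "x \<in> carrier M" if "x \<in> X" for x using that X by blast
  have c: "r \<in> carrier (even_ring R) \<longleftrightarrow> r \<in> rpart R False" for r by (simp add: even_ring_def)
  \<comment> \<open>Negation depends on the carrier, the very field that \<open>even_ring\<close>
    changes, so the agreement of the two negations has to be derived.\<close>
  have minus: "\<ominus>\<^bsub>even_ring R\<^esub> r = \<ominus> r" if "r \<in> rpart R False" for r
    using E.minus_equality[of "\<ominus> r" r] that E.a_inv_closed[of r] E.l_neg[of r]
    by (metis R.minus_equality c even_ring_def partial_object.update_convs(1) rpart_carrier ring.simps(1,2) ring.surjective ring.update_convs(1))
  have closedP: "r \<oplus> s \<in> rpart R False" "r \<otimes> s \<in> rpart R False" "\<ominus> r \<in> rpart R False"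
    if "r \<in> rpart R False" "s \<in> rpart R False" for r s
    using E.a_closed[of r s] E.m_closed[of r s] E.a_inv_closed[of r] that minus
    by (simp_all add: even_ring_def)
  have zero: "\<zero> \<in> rpart R False" using E.zero_closed by (simp add: even_ring_def)
  show ?thesis
  proof (rule idealI[OF E.ring_axioms])
    show "subgroup ?I (add_monoid (even_ring R))"
    proof (rule group.subgroupI[OF E.a_group])
      show "?I \<subseteq> carrier (add_monoid (even_ring R))" by (auto simp: even_ring_def)
      show "?I \<noteq> {}" using zero X' by (auto simp: smult_l_null intro!: exI[of _ \<zero>])
      show "inv\<^bsub>add_monoid (even_ring R)\<^esub> r \<in> ?I" if "r \<in> ?I" for r
        using that X' rpart_carrier
        by (auto simp: minus closedP smult_l_minus simp flip: a_inv_def)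
      show "r \<otimes>\<^bsub>add_monoid (even_ring R)\<^esub> s \<in> ?I" if "r \<in> ?I" "s \<in> ?I" for r s
        using that X' rpart_carrier by (auto simp: even_ring_def closedP smult_l_distr)
    qed
  next
    fix r s assume r: "r \<in> ?I" and s: "s \<in> carrier (even_ring R)"
    have "(s \<otimes> r) \<odot>\<^bsub>M\<^esub> x \<in> K" if "x \<in> X" for x
      using r s closed smult_assoc[OF rpart_carrier[of s False] rpart_carrier[of r False] X'[OF that]] that
      by (simp add: c)
    then show sr: "s \<otimes>\<^bsub>even_ring R\<^esub> r \<in> ?I"
      using r s closedP by (simp add: even_ring_def)
    show "r \<otimes>\<^bsub>even_ring R\<^esub> s \<in> ?I"
      using sr r s by (metis (no_types, lifting) E.m_comm c mem_Collect_eq)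
  qed
qed

end

abbreviation list_prod :: "('a, 'b) ring_scheme \<Rightarrow> 'a list \<Rightarrow> 'a" where
  "list_prod R ys \<equiv> foldr (\<lambda>a b. a \<otimes>\<^bsub>R\<^esub> b) ys \<one>\<^bsub>R\<^esub>"

lemma (in super_ring) rpart_subset: "rpart R p \<subseteq> carrier R"
  using grading by (auto simp: Z2_grading_def dest: additive_subgroup.a_Hcarr)

lemma (in super_ring) list_prod_closed: "set ys \<subseteq> rpart R True \<Longrightarrow> list_prod R ys \<in> carrier R"
  using rpart_subset by (induction ys) auto

text \<open>Each odd factor \<open>a\<close> passed by \<open>y\<close> costs a sign, which is
  absorbed by replacing \<open>a\<close> with \<open>\<ominus> a\<close>, again odd.\<close>

lemma (in super_ring) list_prod_move_to_front:
  assumes "set ys \<subseteq> rpart R True" "y \<in> set ys"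
  shows "\<exists>zs. set zs \<subseteq> rpart R True \<and> Suc (length zs) = length ys
    \<and> list_prod R ys = y \<otimes> list_prod R zs"
  using assms
proof (induction ys)
  case (Cons a ys)
  show ?case
  proof (cases "y = a")
    case True
    then show ?thesis using Cons.prems by (intro exI[of _ ys]) auto
  next
    case False
    then obtain zs where zs: "set zs \<subseteq> rpart R True" "Suc (length zs) = length ys"
      "list_prod R ys = y \<otimes> list_prod R zs" using Cons by auto
    have a: "a \<in> rpart R True" and y: "y \<in> rpart R True" using Cons.prems by auto
    then have c: "a \<in> carrier R" "y \<in> carrier R" using rpart_subset by auto
    have "additive_subgroup (rpart R True) R" using grading by (simp add: Z2_grading_def)
    then have "\<ominus> a \<in> rpart R True" using a by (rule additive_subgroup.a_inv_closed)
    moreover have "a \<otimes> (y \<otimes> list_prod R zs) = y \<otimes> (\<ominus> a \<otimes> list_prod R zs)"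
      using super_comm[OF a y] c list_prod_closed[OF zs(1)]
      by (simp add: m_assoc[symmetric] l_minus r_minus)
    ultimately show ?thesis using zs by (intro exI[of _ "\<ominus> a # zs"]) auto
  qed
qed simp

context supermodule
begin

lemma mult_submodule_trivial_iff:
  assumes "p \<in> carrier R"
  shows "carrier (mult_submodule p M) = {\<zero>\<^bsub>M\<^esub>} \<longleftrightarrow> (\<forall>x\<in>carrier M. p \<odot>\<^bsub>M\<^esub> x = \<zero>\<^bsub>M\<^esub>)"
  using smult_r_null[OF assms]
  by (auto simp: mult_submodule_def image_iff) (use M.zero_closed in blast)

lemma additive_subgroup_image:
  assumes "y \<in> carrier R"
  shows "additive_subgroup ((\<odot>\<^bsub>M\<^esub>) y ` carrier M) M"
proof (rule additive_subgroup.intro, rule group.subgroupI[OF M.a_group])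
  show "(\<odot>\<^bsub>M\<^esub>) y ` carrier M \<subseteq> carrier (add_monoid M)" using assms smult_closed by auto
  show "(\<odot>\<^bsub>M\<^esub>) y ` carrier M \<noteq> {}" by auto
  show "inv\<^bsub>add_monoid M\<^esub> k \<in> (\<odot>\<^bsub>M\<^esub>) y ` carrier M" if k: "k \<in> (\<odot>\<^bsub>M\<^esub>) y ` carrier M" for k
  proof -
    obtain x where "x \<in> carrier M" "k = y \<odot>\<^bsub>M\<^esub> x" using k by blast
    then have "\<ominus>\<^bsub>M\<^esub> k = y \<odot>\<^bsub>M\<^esub> (\<ominus>\<^bsub>M\<^esub> x)" "\<ominus>\<^bsub>M\<^esub> x \<in> carrier M"
      using assms by (auto simp: smult_r_minus)
    then show ?thesis by (auto simp flip: a_inv_def)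
  qed
  show "k \<otimes>\<^bsub>add_monoid M\<^esub> l \<in> (\<odot>\<^bsub>M\<^esub>) y ` carrier M"
    if kl: "k \<in> (\<odot>\<^bsub>M\<^esub>) y ` carrier M" "l \<in> (\<odot>\<^bsub>M\<^esub>) y ` carrier M" for k l
  proof -
    obtain x z where "x \<in> carrier M" "k = y \<odot>\<^bsub>M\<^esub> x" "z \<in> carrier M" "l = y \<odot>\<^bsub>M\<^esub> z"
      using kl by blast
    then have "k \<oplus>\<^bsub>M\<^esub> l = y \<odot>\<^bsub>M\<^esub> (x \<oplus>\<^bsub>M\<^esub> z)" "x \<oplus>\<^bsub>M\<^esub> z \<in> carrier M"
      using assms by (auto simp: smult_r_distr)
    then show ?thesis by auto
  qed
qed

lemma image_closed_even:
  assumes y: "y \<in> rpart R True" and r: "r \<in> rpart R False" and k: "k \<in> (\<odot>\<^bsub>M\<^esub>) y ` carrier M"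
  shows "r \<odot>\<^bsub>M\<^esub> k \<in> (\<odot>\<^bsub>M\<^esub>) y ` carrier M"
proof -
  obtain x where x: "x \<in> carrier M" "k = y \<odot>\<^bsub>M\<^esub> x" using k by blast
  have c: "y \<in> carrier R" "r \<in> carrier R" using y r rpart_carrier by auto
  have "r \<odot>\<^bsub>M\<^esub> k = y \<odot>\<^bsub>M\<^esub> (r \<odot>\<^bsub>M\<^esub> x)"
    using x c R.super_comm[OF r y] by (simp add: smult_assoc[symmetric])
  then show ?thesis using x c smult_closed by blast
qed

text \<open>The multiple of a coset is a union over its representatives. If \<open>r\<close> maps
  into \<open>K\<close>, every set in the union is \<open>K\<close>; conversely the union contains
  the multiple by \<open>r\<close> of each representative.\<close>

lemma quotient_smult_eq_zero_iff:
  assumes K: "additive_subgroup K M" and r: "r \<in> carrier R"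
  shows "(\<forall>C\<in>carrier (quotient_supermodule M K). r \<odot>\<^bsub>quotient_supermodule M K\<^esub> C = K)
    \<longleftrightarrow> (\<forall>x\<in>carrier M. r \<odot>\<^bsub>M\<^esub> x \<in> K)"
proof -
  interpret K: abelian_subgroup K M
    by (rule abelian_subgroupI3[OF K M.abelian_group_axioms])
  let ?s = "\<lambda>C. \<Union>x\<in>C. K +>\<^bsub>M\<^esub> (r \<odot>\<^bsub>M\<^esub> x)"
  have 1: "?s (K +>\<^bsub>M\<^esub> x) = K" if "\<forall>x\<in>carrier M. r \<odot>\<^bsub>M\<^esub> x \<in> K" "x \<in> carrier M" for x
  proof -
    have "K +>\<^bsub>M\<^esub> x \<subseteq> carrier M"
      using that(2) M.a_r_coset_subset_G K.a_subset by blast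
    then have "K +>\<^bsub>M\<^esub> (r \<odot>\<^bsub>M\<^esub> z) = K" if "z \<in> K +>\<^bsub>M\<^esub> x" for z
      using that \<open>\<forall>x\<in>carrier M. r \<odot>\<^bsub>M\<^esub> x \<in> K\<close> K.a_rcos_const by blast
    moreover have "x \<in> K +>\<^bsub>M\<^esub> x" using that(2) K.a_rcos_self by blast
    ultimately show ?thesis by auto
  qed
  have 2: "r \<odot>\<^bsub>M\<^esub> x \<in> K" if "?s (K +>\<^bsub>M\<^esub> x) = K" "x \<in> carrier M" for x
  proof -
    have "x \<in> K +>\<^bsub>M\<^esub> x" using that(2) K.a_rcos_self by blast
    moreover have "r \<odot>\<^bsub>M\<^esub> x \<in> K +>\<^bsub>M\<^esub> (r \<odot>\<^bsub>M\<^esub> x)"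
      using that(2) r smult_closed K.a_rcos_self by blast
    ultimately show ?thesis using that(1) by blast
  qed
  have "carrier (quotient_supermodule M K) = (\<lambda>x. K +>\<^bsub>M\<^esub> x) ` carrier M"
    unfolding quotient_supermodule_def A_RCOSETS_def' by auto
  moreover have "r \<odot>\<^bsub>quotient_supermodule M K\<^esub> C = ?s C" for C
    by (simp add: quotient_supermodule_def)
  ultimately have "(\<forall>C\<in>carrier (quotient_supermodule M K). r \<odot>\<^bsub>quotient_supermodule M K\<^esub> C = K)
      \<longleftrightarrow> (\<forall>x\<in>carrier M. ?s (K +>\<^bsub>M\<^esub> x) = K)"
    by (simp only: ball_simps)
  then show ?thesis using 1 2 by metis
qed

lemma quotient_trivial_iff:
  assumes K: "additive_subgroup K M"
  shows "carrier (quotient_supermodule M K) = {K} \<longleftrightarrow> K = carrier M"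
proof -
  interpret K: abelian_subgroup K M
    by (rule abelian_subgroupI3[OF K M.abelian_group_axioms])
  have c: "carrier (quotient_supermodule M K) = (\<lambda>x. K +>\<^bsub>M\<^esub> x) ` carrier M"
    unfolding quotient_supermodule_def A_RCOSETS_def' by auto
  have "K +>\<^bsub>M\<^esub> x = K \<longleftrightarrow> x \<in> K" if "x \<in> carrier M" for x
    using that K.a_rcos_const K.a_rcos_self by metis
  then have "K = carrier M \<longleftrightarrow> (\<forall>x\<in>carrier M. K +>\<^bsub>M\<^esub> x = K)"
    using K.a_subset by blast
  also have "\<dots> \<longleftrightarrow> (\<lambda>x. K +>\<^bsub>M\<^esub> x) ` carrier M = {K}"
    using M.zero_closed by blast
  finally show ?thesis unfolding c by simp
qed

end

section \<open>Dimension zero, parameter systems and the gap criterion\<close>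

context exterior_algebra
begin

interpretation PS: super_ring P by (rule super_ring_P)

text \<open>Described through \<open>M\<close>, \<open>K\<close> and \<open>X\<close>, the
  annihilator of \<open>N\<close> is an ideal, and the witness \<open>x\<close> keeps the identity
  out of it, so proper quotients of the even part having dimension \<open>0\<close> gives the
  result. This form covers submodules and quotients of \<open>M\<close> alike.\<close>

lemma sdim_eq_0:
  assumes art: "artinian_cring A" and M: "supermodule P M"
    and K: "additive_subgroup K M"
    and closed: "\<And>r k. r \<in> rpart P False \<Longrightarrow> k \<in> K \<Longrightarrow> r \<odot>\<^bsub>M\<^esub> k \<in> K"
    and X: "X \<subseteq> carrier M" "x \<in> X" "x \<notin> K"
    and ann: "even_ann P N = {r \<in> rpart P False. \<forall>x\<in>X. r \<odot>\<^bsub>M\<^esub> x \<in> K}"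
    and N: "carrier N \<noteq> {\<zero>\<^bsub>N\<^esub>}"
  shows "sdim P N = 0"
proof -
  interpret M: supermodule P M by fact
  interpret E: cring "even_ring P" by (rule PS.cring_even_ring)
  have "\<one>\<^bsub>P\<^esub> \<odot>\<^bsub>M\<^esub> x \<notin> K" using X M.smult_one by auto
  then have "\<one>\<^bsub>even_ring P\<^esub> \<notin> even_ann P N"
    using X(2) unfolding ann even_ring_def by auto
  moreover have "ideal (even_ann P N) (even_ring P)"
    unfolding ann by (rule M.ideal_annihilator[OF K X(1) closed])
  ultimately have "Kdim (even_ring P Quot even_ann P N) = 0"
    using even_ring_regular_mod_nilpotent[OF art] by (intro E.Kdim_Quot_eq_0)
  then show ?thesis using N by (simp add: sdim_def)
qed

lemma sdim_submodule_eq_0: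
  assumes art: "artinian_cring A" and M: "supermodule P M"
    and N: "carrier N \<subseteq> carrier M" "smult N = smult M" "\<zero>\<^bsub>N\<^esub> = \<zero>\<^bsub>M\<^esub>"
    and "x \<in> carrier N" "x \<noteq> \<zero>\<^bsub>M\<^esub>"
  shows "sdim P N = 0"
proof (rule sdim_eq_0[OF art M, of "{\<zero>\<^bsub>M\<^esub>}" "carrier N" x])
  interpret M: supermodule P M by fact
  show "additive_subgroup {\<zero>\<^bsub>M\<^esub>} M"
    using group.triv_subgroup[OF M.M.a_group] by (simp add: additive_subgroup_def)
  show "r \<odot>\<^bsub>M\<^esub> k \<in> {\<zero>\<^bsub>M\<^esub>}" if "r \<in> rpart P False" "k \<in> {\<zero>\<^bsub>M\<^esub>}" for r k
    using that M.smult_r_null M.rpart_carrier by auto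
qed (use assms in \<open>auto simp: even_ann_def\<close>)

text \<open>Nonzero modules here have dimension \<open>0\<close> and the zero module has
  \<open>-\<infinity>\<close>, so equality of dimensions only compares which modules vanish.\<close>

lemma odd_parameters_iff:
  assumes art: "artinian_cring A" and M: "supermodule P M" and nz: "carrier M \<noteq> {\<zero>\<^bsub>M\<^esub>}"
  shows "odd_parameters P M ys \<longleftrightarrow> ys \<noteq> [] \<and> set ys \<subseteq> rpart P True
    \<and> (\<exists>x\<in>carrier M. list_prod P ys \<odot>\<^bsub>M\<^esub> x \<noteq> \<zero>\<^bsub>M\<^esub>)"
proof -
  interpret M: supermodule P M by fact
  obtain m where "m \<in> carrier M" "m \<noteq> \<zero>\<^bsub>M\<^esub>" using nz M.M.zero_closed by blast
  then have sdim_M: "sdim P M = 0" by (intro sdim_submodule_eq_0[OF art M order_refl refl refl])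
  have sdim_p: "sdim P (mult_submodule p M) =
      (if \<exists>x\<in>carrier M. p \<odot>\<^bsub>M\<^esub> x \<noteq> \<zero>\<^bsub>M\<^esub> then 0 else -\<infinity>)" if p: "p \<in> carrier P" for p
  proof (cases "\<exists>x\<in>carrier M. p \<odot>\<^bsub>M\<^esub> x \<noteq> \<zero>\<^bsub>M\<^esub>")
    case True
    then obtain x where "x \<in> carrier M" "p \<odot>\<^bsub>M\<^esub> x \<noteq> \<zero>\<^bsub>M\<^esub>" by blast
    then have "sdim P (mult_submodule p M) = 0"
      using p M.smult_closed
      by (intro sdim_submodule_eq_0[OF art M, of _ "p \<odot>\<^bsub>M\<^esub> x"]) (auto simp: mult_submodule_def)
    then show ?thesis using True by simp
  next
    case False
    then show ?thesis
      using M.mult_submodule_trivial_iff[OF p] by (simp add: sdim_def mult_submodule_def)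
  qed
  show ?thesis
  proof (cases "set ys \<subseteq> rpart P True")
    case True
    have "(if Q then 0 else -\<infinity>) = (0 :: ereal) \<longleftrightarrow> Q" for Q by simp
    then show ?thesis
      unfolding odd_parameters_def sdim_M sdim_p[OF PS.list_prod_closed[OF True]] using True by blast
  qed (simp add: odd_parameters_def)
qed

text \<open>The quotient by the proper subgroup \<open>K\<close> has dimension \<open>0\<close>; a
  product mapping \<open>M\<close> into \<open>K\<close> would give the zero module, of dimension
  \<open>-\<infinity>\<close>. This serves to bound the odd dimension of the quotient from
  above.\<close>

lemma odd_parameters_quotient:
  assumes art: "artinian_cring A" and M: "supermodule P M" and y: "y \<in> rpart P True"
    and K_def: "K = (\<odot>\<^bsub>M\<^esub>) y ` carrier M" and ne: "K \<noteq> carrier M"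
    and ys: "odd_parameters P (quotient_supermodule M K) ys"
  shows "set ys \<subseteq> rpart P True" and "\<exists>x\<in>carrier M. list_prod P ys \<odot>\<^bsub>M\<^esub> x \<notin> K"
proof -
  interpret M: supermodule P M by fact
  let ?Q = "quotient_supermodule M K"
  have yc: "y \<in> carrier P" using y M.rpart_carrier by blast
  note K = M.additive_subgroup_image[OF yc, folded K_def]
  have zero: "\<zero>\<^bsub>?Q\<^esub> = K" by (simp add: quotient_supermodule_def)
  show s: "set ys \<subseteq> rpart P True" using ys by (simp add: odd_parameters_def)
  obtain x where x: "x \<in> carrier M" "x \<notin> K"
    using ne additive_subgroup.a_subset[OF K] by blast
  have "sdim P ?Q = 0"
  proof (rule sdim_eq_0[OF art M K _ order_refl x])
    show "even_ann P ?Q = {r \<in> rpart P False. \<forall>x\<in>carrier M. r \<odot>\<^bsub>M\<^esub> x \<in> K}"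
      unfolding even_ann_def zero
      using M.quotient_smult_eq_zero_iff[OF K M.rpart_carrier] by blast
    show "carrier ?Q \<noteq> {\<zero>\<^bsub>?Q\<^esub>}"
      unfolding zero using M.quotient_trivial_iff[OF K] ne by blast
  qed (use M.image_closed_even[OF y] K_def in blast)
  then have "sdim P (mult_submodule (list_prod P ys) ?Q) = 0"
    using ys by (simp add: odd_parameters_def)
  moreover have "sdim P (mult_submodule p ?Q) = -\<infinity>" if "\<forall>C\<in>carrier ?Q. p \<odot>\<^bsub>?Q\<^esub> C = K" for p
  proof -
    have "carrier ?Q \<noteq> {}" unfolding quotient_supermodule_def A_RCOSETS_def' using x by auto
    then have "carrier (mult_submodule p ?Q) = {K}"
      unfolding mult_submodule_def using that by force
    moreover have "\<zero>\<^bsub>mult_submodule p ?Q\<^esub> = K" by (simp add: mult_submodule_def zero)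
    ultimately show ?thesis by (simp add: sdim_def)
  qed
  ultimately have "\<not> (\<forall>C\<in>carrier ?Q. list_prod P ys \<odot>\<^bsub>?Q\<^esub> C = K)"
    by fastforce
  then show "\<exists>x\<in>carrier M. list_prod P ys \<odot>\<^bsub>M\<^esub> x \<notin> K"
    using M.quotient_smult_eq_zero_iff[OF K PS.list_prod_closed[OF s]] by blast
qed

text \<open>The list \<open>zs\<close> makes the odd dimension of \<open>M\<close> at least three,
  while \<open>sq\<close> bounds that of the quotient by one. A longest system containing
  \<open>y\<close> would have at least two other members; their product maps into the image of
  \<open>y\<close>, which \<open>y\<close> annihilates.\<close>

theorem sdim1_gap:
  assumes art: "artinian_cring A" and M: "supermodule P M" and reg: "odd_regular P M y"
    and sq: "\<And>a b x. a \<in> rpart P True \<Longrightarrow> b \<in> rpart P True \<Longrightarrow> x \<in> carrier M \<Longrightarrow>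
      (a \<otimes>\<^bsub>P\<^esub> b) \<odot>\<^bsub>M\<^esub> x \<in> (\<odot>\<^bsub>M\<^esub>) y ` carrier M"
    and z: "set zs \<subseteq> rpart P True" "length zs = 3" "m \<in> carrier M" "list_prod P zs \<odot>\<^bsub>M\<^esub> m \<noteq> \<zero>\<^bsub>M\<^esub>"
  shows "carrier M \<noteq> {\<zero>\<^bsub>M\<^esub>}"
    and "sdim1 P (quotient_supermodule M (carrier (mult_submodule y M))) < sdim1 P M - 1"
    and "\<forall>ys. longest_odd_parameters P M ys \<longrightarrow> y \<notin> set ys"
proof -
  interpret M: supermodule P M by fact
  have y: "y \<in> rpart P True" using reg by (simp add: odd_regular_def)
  then have yc: "y \<in> carrier P" using M.rpart_carrier by blast
  have yy: "y \<odot>\<^bsub>M\<^esub> k = \<zero>\<^bsub>M\<^esub>" if "k \<in> (\<odot>\<^bsub>M\<^esub>) y ` carrier M" for k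
    using reg that by (auto simp: odd_regular_def)
  have prod2: "list_prod P ys \<odot>\<^bsub>M\<^esub> x \<in> (\<odot>\<^bsub>M\<^esub>) y ` carrier M"
    if ys: "set ys \<subseteq> rpart P True" "length ys \<ge> 2" "x \<in> carrier M" for ys x
  proof -
    \<comment> \<open>The first two factors suffice: the remaining ones only move \<open>x\<close>
      inside \<open>M\<close>.\<close>
    obtain a b r where r: "ys = a # b # r"
      using ys(2) by (metis One_nat_def Suc_1 Suc_le_length_iff)
    have c: "a \<in> carrier P" "b \<in> carrier P" "list_prod P r \<in> carrier P"
      using ys r M.rpart_carrier PS.list_prod_closed by auto
    then have "list_prod P ys \<odot>\<^bsub>M\<^esub> x = (a \<otimes>\<^bsub>P\<^esub> b) \<odot>\<^bsub>M\<^esub> (list_prod P r \<odot>\<^bsub>M\<^esub> x)"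
      using ys(3) r M.smult_closed by (simp add: M.smult_assoc)
    then show ?thesis using sq ys r c M.smult_closed by auto
  qed
  have zc: "list_prod P zs \<in> carrier P" using z PS.list_prod_closed by blast
  show nz: "carrier M \<noteq> {\<zero>\<^bsub>M\<^esub>}"
    using z M.smult_r_null[OF zc] by auto
  note params = odd_parameters_iff[OF art M nz]
  have "odd_parameters P M zs" unfolding params using z by auto
  then have ge3: "enat 3 \<le> sdim1 P M"
    unfolding sdim1_def using z(2) by (intro Sup_upper) auto
  show "\<forall>ys. longest_odd_parameters P M ys \<longrightarrow> y \<notin> set ys"
  proof (intro allI impI notI)
    fix ys assume ys: "longest_odd_parameters P M ys" "y \<in> set ys"
    then have "enat 3 \<le> enat (length ys)" and op: "odd_parameters P M ys"
      using ge3 by (simp_all add: longest_odd_parameters_def)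
    then have "3 \<le> length ys" by simp
    have "set ys \<subseteq> rpart P True" using op unfolding params by blast
    then obtain us where us: "set us \<subseteq> rpart P True" "Suc (length us) = length ys"
      "list_prod P ys = y \<otimes>\<^bsub>P\<^esub> list_prod P us"
      using PS.list_prod_move_to_front[OF _ ys(2)] by blast
    have "list_prod P ys \<odot>\<^bsub>M\<^esub> x = \<zero>\<^bsub>M\<^esub>" if "x \<in> carrier M" for x
    proof -
      have "list_prod P ys \<odot>\<^bsub>M\<^esub> x = y \<odot>\<^bsub>M\<^esub> (list_prod P us \<odot>\<^bsub>M\<^esub> x)"
        unfolding us(3) by (rule M.smult_assoc[OF yc PS.list_prod_closed[OF us(1)] that])
      also have "\<dots> = \<zero>\<^bsub>M\<^esub>"
        using us(2) \<open>3 \<le> length ys\<close> by (intro yy prod2[OF us(1) _ that]) simp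
      finally show ?thesis .
    qed
    then show False using op unfolding params by blast
  qed
  have "(\<odot>\<^bsub>M\<^esub>) y ` carrier M \<noteq> carrier M"
  proof
    \<comment> \<open>Were multiplication by \<open>y\<close> surjective, \<open>y\<close> would
      annihilate its image, which is all of the nonzero module \<open>M\<close>.\<close>
    assume eq: "(\<odot>\<^bsub>M\<^esub>) y ` carrier M = carrier M"
    obtain x where x: "x \<in> carrier M" "x \<noteq> \<zero>\<^bsub>M\<^esub>" using nz M.M.zero_closed by blast
    then obtain x' where x': "x' \<in> carrier M" "x = y \<odot>\<^bsub>M\<^esub> x'" using eq by blast
    then show False using x(2) yy[of x'] unfolding eq by simp
  qed
  note quot = odd_parameters_quotient[OF art M y refl this]
  have "sdim1 P (quotient_supermodule M ((\<odot>\<^bsub>M\<^esub>) y ` carrier M)) \<le> enat 1"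
    unfolding sdim1_def
  proof (rule Sup_least, clarify)
    fix ys assume "odd_parameters P (quotient_supermodule M ((\<odot>\<^bsub>M\<^esub>) y ` carrier M)) ys"
    from quot[OF this] prod2 show "enat (length ys) \<le> enat 1"
      by (metis One_nat_def Suc_1 enat_ord_simps(1) not_less_eq_eq)
  qed
  \<comment> \<open>The odd dimension of \<open>M\<close> is an extended natural number; the
    infinite case, where subtracting one changes nothing, is treated separately.\<close>
  also have "enat 1 < sdim1 P M - 1"
    using ge3 by (cases "sdim1 P M") (auto simp: one_enat_def)
  finally show "sdim1 P (quotient_supermodule M (carrier (mult_submodule y M))) < sdim1 P M - 1"
    by (simp add: mult_submodule_def)
qed

end

section \<open>Constructions of supermodules\<close>

text \<open>Asking only for some left negative inside \<open>H\<close> allows negatives to be taken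
  from another structure with the same addition.\<close>

lemma (in abelian_group) additive_subgroupI:
  assumes "H \<subseteq> carrier G" "\<zero> \<in> H"
    and add: "\<And>x y. x \<in> H \<Longrightarrow> y \<in> H \<Longrightarrow> x \<oplus> y \<in> H"
    and neg: "\<And>x. x \<in> H \<Longrightarrow> \<exists>y\<in>H. y \<oplus> x = \<zero>"
  shows "additive_subgroup H G"
proof (rule additive_subgroup.intro, rule group.subgroupI[OF a_group])
  fix x assume x: "x \<in> H"
  then obtain y where "y \<in> H" "y \<oplus> x = \<zero>" using neg by blast
  then show "inv\<^bsub>add_monoid G\<^esub> x \<in> H"
    using minus_equality[of y x] x assms(1) by (auto simp flip: a_inv_def)
qed (use assms in auto)

text \<open>The scalars come from a smaller super-ring inside \<open>Q\<close>, so \<open>H\<close>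
  may fail to be an ideal of \<open>Q\<close>.\<close>

definition sub_supermodule :: "('a, 'd) super_ring_scheme \<Rightarrow> 'a set \<Rightarrow> ('a, 'a) supermodule" where
  "sub_supermodule Q H = \<lparr>carrier = H, monoid.mult = undefined, one = undefined, zero = \<zero>\<^bsub>Q\<^esub>,
     add = add Q, smult = (\<otimes>\<^bsub>Q\<^esub>), mpart = (\<lambda>p. H \<inter> rpart Q p)\<rparr>"

lemma supermodule_sub_supermodule:
  fixes R :: "('a, 'c) super_ring_scheme" and Q :: "('a, 'd) super_ring_scheme"
  assumes R: "super_ring R" and Q: "super_ring Q"
    and ops: "monoid.mult R = monoid.mult Q" "ring.add R = ring.add Q" "\<one>\<^bsub>R\<^esub> = \<one>\<^bsub>Q\<^esub>"
    and RQ: "carrier R \<subseteq> carrier Q" "\<And>p. rpart R p \<subseteq> rpart Q p"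
    and H: "H \<subseteq> carrier Q" "\<zero>\<^bsub>Q\<^esub> \<in> H"
    and add: "\<And>x y. x \<in> H \<Longrightarrow> y \<in> H \<Longrightarrow> x \<oplus>\<^bsub>Q\<^esub> y \<in> H"
    and mult: "\<And>r x. r \<in> carrier R \<Longrightarrow> x \<in> H \<Longrightarrow> r \<otimes>\<^bsub>Q\<^esub> x \<in> H"
    and graded: "\<And>x. x \<in> H \<Longrightarrow>
      \<exists>u\<in>H \<inter> rpart Q False. \<exists>v\<in>H \<inter> rpart Q True. x = u \<oplus>\<^bsub>Q\<^esub> v"
  shows "supermodule R (sub_supermodule Q H)" (is "supermodule R ?M")
proof -
  interpret R: super_ring R by fact
  interpret Q: super_ring Q by fact
  have Hc: "x \<in> carrier Q" if "x \<in> H" for x using that H by blast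
  have Rc: "r \<in> carrier Q" if "r \<in> carrier R" for r using that RQ by blast
  \<comment> \<open>This scalar is minus one: closure of \<open>H\<close> under \<open>R\<close>
    then gives closure under negation.\<close>
  define n where "n = \<ominus>\<^bsub>R\<^esub> \<one>\<^bsub>R\<^esub>"
  have nR: "n \<in> carrier R" by (simp add: n_def)
  have "n \<oplus>\<^bsub>Q\<^esub> \<one>\<^bsub>Q\<^esub> = \<zero>\<^bsub>R\<^esub>" using R.l_neg[OF R.one_closed] by (simp add: n_def ops)
  \<comment> \<open>The zero of \<open>R\<close> is additively idempotent in \<open>Q\<close>, which
    forces it to be the zero of \<open>Q\<close>.\<close>
  moreover have "\<zero>\<^bsub>R\<^esub> = \<zero>\<^bsub>Q\<^esub>"
  proof -
    have "\<zero>\<^bsub>R\<^esub> \<oplus>\<^bsub>Q\<^esub> \<zero>\<^bsub>R\<^esub> = \<zero>\<^bsub>R\<^esub>" using R.l_zero[of "\<zero>\<^bsub>R\<^esub>"] by (simp add: ops)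
    then show ?thesis using Rc[of "\<zero>\<^bsub>R\<^esub>"] Q.add.r_cancel_one'[of "\<zero>\<^bsub>R\<^esub>" "\<zero>\<^bsub>R\<^esub>"] by simp
  qed
  ultimately have n: "n \<oplus>\<^bsub>Q\<^esub> \<one>\<^bsub>Q\<^esub> = \<zero>\<^bsub>Q\<^esub>" by simp
  have neg: "n \<otimes>\<^bsub>Q\<^esub> x \<in> H" "n \<otimes>\<^bsub>Q\<^esub> x \<oplus>\<^bsub>Q\<^esub> x = \<zero>\<^bsub>Q\<^esub>" if x: "x \<in> H" for x
  proof -
    show "n \<otimes>\<^bsub>Q\<^esub> x \<in> H" using nR x by (rule mult)
    have "n \<otimes>\<^bsub>Q\<^esub> x \<oplus>\<^bsub>Q\<^esub> x = (n \<oplus>\<^bsub>Q\<^esub> \<one>\<^bsub>Q\<^esub>) \<otimes>\<^bsub>Q\<^esub> x"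
      using Rc[OF nR] Hc[OF x] by (simp add: Q.l_distr)
    then show "n \<otimes>\<^bsub>Q\<^esub> x \<oplus>\<^bsub>Q\<^esub> x = \<zero>\<^bsub>Q\<^esub>" using n Hc[OF x] by simp
  qed
  have G: "abelian_group ?M"
  proof (rule abelian_groupI)
    show "\<exists>y\<in>carrier ?M. y \<oplus>\<^bsub>?M\<^esub> x = \<zero>\<^bsub>?M\<^esub>" if "x \<in> carrier ?M" for x
      using that by (intro bexI[of _ "n \<otimes>\<^bsub>Q\<^esub> x"]) (simp_all add: sub_supermodule_def neg)
  qed (use H add in \<open>auto simp: sub_supermodule_def Hc Q.a_ac\<close>)
  interpret M: abelian_group ?M by (rule G)
  have "Z2_grading ?M (mpart ?M)"
    unfolding Z2_grading_def
  proof (intro conjI allI)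
    fix p
    interpret p: additive_subgroup "rpart Q p" Q
      using Q.grading by (simp add: Z2_grading_def)
    show "additive_subgroup (mpart ?M p) ?M"
    proof (rule M.additive_subgroupI)
      fix x assume "x \<in> mpart ?M p"
      then have x: "x \<in> H" "x \<in> rpart Q p" by (auto simp: sub_supermodule_def)
      have "n \<otimes>\<^bsub>Q\<^esub> x = \<ominus>\<^bsub>Q\<^esub> x"
        using neg[OF x(1)] Hc x(1) by (metis Q.minus_equality)
      then have "n \<otimes>\<^bsub>Q\<^esub> x \<in> rpart Q p" using x by simp
      then show "\<exists>y\<in>mpart ?M p. y \<oplus>\<^bsub>?M\<^esub> x = \<zero>\<^bsub>?M\<^esub>"
        using neg[OF x(1)] by (auto simp: sub_supermodule_def)
    qed (use H add in \<open>auto simp: sub_supermodule_def\<close>)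
  next
    show "carrier ?M = mpart ?M False <+>\<^bsub>?M\<^esub> mpart ?M True"
    proof
      show "carrier ?M \<subseteq> mpart ?M False <+>\<^bsub>?M\<^esub> mpart ?M True"
        using graded unfolding set_add_def set_mult_def by (force simp: sub_supermodule_def)
      show "mpart ?M False <+>\<^bsub>?M\<^esub> mpart ?M True \<subseteq> carrier ?M"
        using add unfolding set_add_def set_mult_def by (auto simp: sub_supermodule_def)
    qed
    have "rpart Q False \<inter> rpart Q True = {\<zero>\<^bsub>Q\<^esub>}"
      using Q.grading by (simp add: Z2_grading_def)
    then show "mpart ?M False \<inter> mpart ?M True = {\<zero>\<^bsub>?M\<^esub>}"
      using H(2) by (auto simp: sub_supermodule_def)
  qed
  then show ?thesis
  proof (intro supermodule.intro supermodule_axioms.intro R G)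
    fix r x p q assume "r \<in> rpart R p" "x \<in> mpart ?M q"
    then show "r \<odot>\<^bsub>?M\<^esub> x \<in> mpart ?M (p \<noteq> q)"
      using Q.mult_part[of r p x q] RQ(2) mult R.rpart_subset[of p] by (auto simp: sub_supermodule_def)
  qed (use Hc Rc mult ops in \<open>auto simp: sub_supermodule_def Q.l_distr Q.r_distr Q.m_assoc\<close>)
qed

section \<open>Transport of supermodules along injections\<close>

text \<open>The module is built from families indexed by \<open>nat set\<close>, whereas the theorem
  asks for elements of type \<open>nat \<Rightarrow> 'a set\<close>. Copying along an injection
  \<open>h\<close> bridges this.\<close>

definition transport_supermodule ::
    "('b \<Rightarrow> 'e) \<Rightarrow> ('a, 'b, 'c) supermodule_scheme \<Rightarrow> ('a, 'e) supermodule" where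
  "transport_supermodule h M = (let g = inv_into (carrier M) h in
     \<lparr>carrier = h ` carrier M, monoid.mult = undefined, one = undefined, zero = h \<zero>\<^bsub>M\<^esub>,
      add = (\<lambda>x y. h (g x \<oplus>\<^bsub>M\<^esub> g y)), smult = (\<lambda>r x. h (r \<odot>\<^bsub>M\<^esub> g x)),
      mpart = (\<lambda>p. h ` mpart M p)\<rparr>)"

locale supermodule_transport = supermodule R M
  for R :: "('a, 'd) super_ring_scheme" (structure) and M :: "('a, 'b, 'c) supermodule_scheme" (structure) +
  fixes h :: "'b \<Rightarrow> 'e"
  assumes inj: "inj_on h (carrier M)"
begin

abbreviation T :: "('a, 'e) supermodule" where "T \<equiv> transport_supermodule h M"

lemma transport_carrier: "carrier T = h ` carrier M"
  and transport_mpart: "mpart T p = h ` mpart M p"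
  and transport_zero: "\<zero>\<^bsub>T\<^esub> = h \<zero>\<^bsub>M\<^esub>"
  by (simp_all add: transport_supermodule_def Let_def)

lemma transport_smult: "x \<in> carrier M \<Longrightarrow> r \<odot>\<^bsub>T\<^esub> h x = h (r \<odot>\<^bsub>M\<^esub> x)"
  by (simp add: transport_supermodule_def Let_def inv_into_f_f[OF inj])

lemma transport_add: "x \<in> carrier M \<Longrightarrow> y \<in> carrier M \<Longrightarrow> h x \<oplus>\<^bsub>T\<^esub> h y = h (x \<oplus>\<^bsub>M\<^esub> y)"
  by (simp add: transport_supermodule_def Let_def inv_into_f_f[OF inj])

lemma transport_eq_iff: "x \<in> carrier M \<Longrightarrow> y \<in> carrier M \<Longrightarrow> h x = h y \<longleftrightarrow> x = y"
  using inj by (auto dest: inj_onD)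

lemma mpart_carrier: "x \<in> mpart M p \<Longrightarrow> x \<in> carrier M"
  using mgrading by (auto simp: Z2_grading_def dest: additive_subgroup.a_Hcarr)

lemma transport_neg: "x \<in> carrier M \<Longrightarrow> h (\<ominus>\<^bsub>M\<^esub> x) \<oplus>\<^bsub>T\<^esub> h x = \<zero>\<^bsub>T\<^esub>"
  by (simp add: transport_add transport_zero M.l_neg)

lemma transport_abelian_group: "abelian_group T"
proof (rule abelian_groupI)
  fix x assume "x \<in> carrier T"
  then obtain a where a: "a \<in> carrier M" "x = h a" by (auto simp: transport_carrier)
  then show "\<exists>y\<in>carrier T. y \<oplus>\<^bsub>T\<^esub> x = \<zero>\<^bsub>T\<^esub>"
    using transport_neg by (auto simp: transport_carrier)
qed (auto simp: transport_carrier transport_add transport_zero M.a_ac)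

lemma transport_grading: "Z2_grading T (mpart T)"
proof -
  interpret T: abelian_group T by (rule transport_abelian_group)
  show ?thesis
    unfolding Z2_grading_def
  proof (intro conjI allI)
    fix p
    interpret p: additive_subgroup "mpart M p" M
      using mgrading by (simp add: Z2_grading_def)
    show "additive_subgroup (mpart T p) T"
    proof (rule T.additive_subgroupI)
      fix x assume "x \<in> mpart T p"
      then obtain a where a: "a \<in> mpart M p" "x = h a" by (auto simp: transport_mpart)
      then show "\<exists>y\<in>mpart T p. y \<oplus>\<^bsub>T\<^esub> x = \<zero>\<^bsub>T\<^esub>"
        using transport_neg[of a] mpart_carrier by (auto simp: transport_mpart)
    qed (auto simp: transport_mpart transport_carrier transport_zero transport_add)
  next
    have M: "carrier M = mpart M False <+>\<^bsub>M\<^esub> mpart M True"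
      using mgrading by (simp add: Z2_grading_def)
    show "carrier T = mpart T False <+>\<^bsub>T\<^esub> mpart T True"
    proof
      show "mpart T False <+>\<^bsub>T\<^esub> mpart T True \<subseteq> carrier T"
        unfolding set_add_def set_mult_def transport_mpart transport_carrier
        using mpart_carrier by (auto simp: transport_add)
      show "carrier T \<subseteq> mpart T False <+>\<^bsub>T\<^esub> mpart T True"
      proof
        fix x assume "x \<in> carrier T"
        then obtain a where a: "a \<in> carrier M" "x = h a" by (auto simp: transport_carrier)
        have "a \<in> mpart M False <+>\<^bsub>M\<^esub> mpart M True" using a(1) unfolding M .
        then obtain u v where uv: "u \<in> mpart M False" "v \<in> mpart M True" "a = u \<oplus>\<^bsub>M\<^esub> v"
          unfolding set_add_def set_mult_def by auto
        then have "x = h u \<oplus>\<^bsub>T\<^esub> h v" using a(2) mpart_carrier by (simp add: transport_add)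
        then show "x \<in> mpart T False <+>\<^bsub>T\<^esub> mpart T True"
          using uv unfolding set_add_def set_mult_def transport_mpart by auto
      qed
    qed
    have "mpart M False \<inter> mpart M True = {\<zero>\<^bsub>M\<^esub>}"
      using mgrading by (simp add: Z2_grading_def)
    moreover have "h ` (mpart M False \<inter> mpart M True) = mpart T False \<inter> mpart T True"
      unfolding transport_mpart using mpart_carrier by (intro inj_on_image_Int[OF inj]) auto
    ultimately show "mpart T False \<inter> mpart T True = {\<zero>\<^bsub>T\<^esub>}"
      by (simp add: transport_zero)
  qed
qed

lemma supermodule_transport: "supermodule R T"
proof (intro supermodule.intro supermodule_axioms.intro R.super_ring_axioms
    transport_abelian_group transport_grading)
  fix r x p q assume r: "r \<in> rpart R p" and "x \<in> mpart T q"
  then obtain a where a: "a \<in> mpart M q" "x = h a" by (auto simp: transport_mpart)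
  then show "r \<odot>\<^bsub>T\<^esub> x \<in> mpart T (p \<noteq> q)"
    using smult_part[OF r a(1)] mpart_carrier by (auto simp: transport_mpart transport_smult)
qed (auto simp: transport_carrier transport_smult transport_add smult_closed
    smult_l_distr smult_r_distr smult_assoc smult_one)

lemma transport_image_smult:
  "(\<odot>\<^bsub>T\<^esub>) r ` carrier T = h ` (\<odot>\<^bsub>M\<^esub>) r ` carrier M"
  by (force simp: transport_carrier transport_smult image_image)

lemma transport_odd_regular:
  assumes "odd_regular R M y"
  shows "odd_regular R T y"
proof -
  have y: "y \<in> rpart R True" "{m \<in> carrier M. y \<odot>\<^bsub>M\<^esub> m = \<zero>\<^bsub>M\<^esub>} = (\<odot>\<^bsub>M\<^esub>) y ` carrier M"
    using assms by (auto simp: odd_regular_def)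
  have "{m \<in> carrier T. y \<odot>\<^bsub>T\<^esub> m = \<zero>\<^bsub>T\<^esub>} = h ` {m \<in> carrier M. y \<odot>\<^bsub>M\<^esub> m = \<zero>\<^bsub>M\<^esub>}"
    using rpart_carrier[OF y(1)] smult_closed
    by (auto simp: transport_carrier transport_smult transport_zero transport_eq_iff)
  then show ?thesis
    unfolding odd_regular_def transport_image_smult y(2) using y(1) by simp
qed

end

section \<open>Generators of the polynomial super-ring\<close>

lemma poly_super_ring_mono:
  assumes "V \<subseteq> W"
  shows "carrier (poly_super_ring A V) \<subseteq> carrier (poly_super_ring A W)"
    and "rpart (poly_super_ring A V) p \<subseteq> rpart (poly_super_ring A W) p"
  using assms by (auto simp: poly_super_ring_def Let_def)

text \<open>The set of generators enters only through the support condition, so super-rings on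
  different generators share their operations, and the smaller one sits inside the larger.\<close>

lemma poly_super_ring_ops:
  "monoid.mult (poly_super_ring A V) = monoid.mult (poly_super_ring A W)"
  "ring.add (poly_super_ring A V) = ring.add (poly_super_ring A W)"
  "monoid.one (poly_super_ring A V) = monoid.one (poly_super_ring A W)"
  "ring.zero (poly_super_ring A V) = ring.zero (poly_super_ring A W)"
  by (simp_all add: poly_super_ring_def Let_def)

section \<open>Multiplication and contraction by one generator\<close>

context exterior_algebra
begin

lemma psign_square: "psign n \<otimes> psign n = \<one>"
  by (simp add: psign_def l_minus)

lemma odd_gen_in_rpart: "i \<in> V \<Longrightarrow> odd_gen A i \<in> rpart P True"
  by (auto simp: P_rpart P_carrier odd_gen_def)

lemma odd_gen_mult:
  assumes "i \<in> V" "f \<in> carrier P"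
  shows "(odd_gen A i \<otimes>\<^bsub>P\<^esub> f) S =
    (if i \<in> S \<and> S \<subseteq> V then psign (inversions {i} (S - {i})) \<otimes> f (S - {i}) else \<zero>)"
proof -
  have g: "odd_gen A i \<in> carrier P" using odd_gen_in_rpart[OF assms(1)] by (simp add: P_rpart)
  consider "\<not> S \<subseteq> V" | "S \<subseteq> V" "i \<notin> S" | "S \<subseteq> V" "i \<in> S" by blast
  then show ?thesis
  proof cases
    case 1
    then show ?thesis by (simp add: P_mult_outside[OF g assms(2)])
  next
    case 2
    then have "(odd_gen A i \<otimes>\<^bsub>P\<^esub> f) S = \<zero>"
      by (intro P_mult_zero[OF g assms(2)]) (auto simp: odd_gen_def)
    then show ?thesis using 2 by simp
  next
    case 3
    then have "finite S" using finite_V finite_subset by blast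
    then have "(odd_gen A i \<otimes>\<^bsub>P\<^esub> f) S = psign (inversions {i} (S - {i})) \<otimes> (odd_gen A i {i} \<otimes> f (S - {i}))"
      using 3 by (intro P_mult_single[OF g assms(2)]) (auto simp: odd_gen_def)
    then show ?thesis using 3 P_carrierD[OF assms(2)] by (simp add: odd_gen_def)
  qed
qed

text \<open>The interior product with the \<open>i\<close>-th generator. The sign is chosen so that
  left multiplication by the generator restores the monomials from which \<open>i\<close> was
  stripped.\<close>

definition contract :: "nat \<Rightarrow> (nat set \<Rightarrow> 'a) \<Rightarrow> nat set \<Rightarrow> 'a" where
  "contract i f S = (if i \<in> S then \<zero> else psign (inversions {i} S) \<otimes> f (insert i S))"

lemma contract_closed: "f \<in> carrier P \<Longrightarrow> contract i f \<in> carrier P"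
  by (auto simp: P_carrier contract_def)

lemma odd_gen_mult_contract:
  assumes "i \<in> V" "f \<in> carrier P"
  shows "odd_gen A i \<otimes>\<^bsub>P\<^esub> contract i f = (\<lambda>S. if i \<in> S then f S else \<zero>)"
proof
  fix S
  have "psign n \<otimes> (psign n \<otimes> f S) = f S" for n
    using P_carrierD[OF assms(2), of S] by (simp add: psign_square flip: m_assoc)
  then show "(odd_gen A i \<otimes>\<^bsub>P\<^esub> contract i f) S = (if i \<in> S then f S else \<zero>)"
    using P_outside[OF assms(2), of S]
    by (auto simp: odd_gen_mult[OF assms(1) contract_closed[OF assms(2)]] contract_def insert_absorb)
qed

lemma odd_gen_decomposition:
  assumes "i \<in> V" "f \<in> carrier P"
  shows "f = odd_gen A i \<otimes>\<^bsub>P\<^esub> contract i f \<oplus>\<^bsub>P\<^esub> (\<lambda>S. if i \<in> S then \<zero> else f S)"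
  using P_carrierD[OF assms(2)] by (auto simp: odd_gen_mult_contract[OF assms] P_add)

text \<open>Up to sign, the coefficient of the product at \<open>insert i S\<close> is that of
  \<open>f\<close> at \<open>S\<close>.\<close>

lemma odd_gen_mult_eq_zeroD:
  assumes "i \<in> V" "f \<in> carrier P" "odd_gen A i \<otimes>\<^bsub>P\<^esub> f = \<zero>\<^bsub>P\<^esub>" "i \<notin> S"
  shows "f S = \<zero>"
proof (cases "S \<subseteq> V")
  case True
  then have "\<zero>\<^bsub>P\<^esub> (insert i S) = psign (inversions {i} S) \<otimes> f S"
    using odd_gen_mult[OF assms(1,2), of "insert i S"] assms(1,4) unfolding assms(3) by simp
  then show ?thesis
    using psign_mult_eq_zero_iff P_carrierD[OF assms(2), of S] by (metis P_zero)
qed (simp add: P_outside assms)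

end

section \<open>The module\<close>

text \<open>Indices \<open>1\<close>, \<open>2\<close>, \<open>3\<close> stand for
  \<open>Z_1\<close>, \<open>Z_2\<close>, \<open>Z_3\<close>, index \<open>4\<close> for
  \<open>Y\<close>, and \<open>5\<close>, \<open>6\<close>, \<open>7\<close> for the adjoined
  \<open>a_1\<close>, \<open>a_2\<close>, \<open>a_3\<close>. Below, \<open>R.P\<close> is the given
  super-ring and \<open>Q.P\<close> the enlarged one.\<close>

locale gap_example = A?: cring A for A (structure)
begin

declare One_nat_def [simp del] \<comment> \<open>else the index sets are rewritten and \<open>R.P\<close>, \<open>Q.P\<close> no longer match\<close>

sublocale R: exterior_algebra A "{1, 2, 3, 4}"
  by unfold_locales simp

sublocale Q: exterior_algebra A "{1..7}"
  by unfold_locales simp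

sublocale RR: super_ring R.P by (rule R.super_ring_P)

sublocale QR: super_ring Q.P by (rule Q.super_ring_P)

abbreviation Y :: "nat set \<Rightarrow> 'a" where "Y \<equiv> odd_gen A 4"

text \<open>The monomial ideal generated by the products of two distinct \<open>Z_i\<close>,
  expressed through supports so that membership can be checked coefficient by coefficient.\<close>

definition "J = {f \<in> carrier R.P. \<forall>S. f S \<noteq> \<zero> \<longrightarrow> 2 \<le> card (S \<inter> {1, 2, 3})}"

text \<open>All coefficients are \<open>\<one>\<close> because the factors of each
  \<open>Z_i Z_j a_k\<close> stand in increasing order of their indices.\<close>

definition e :: "nat set \<Rightarrow> 'a" where
  "e = (\<lambda>S. if S \<in> {{2, 3, 5}, {1, 3, 6}, {1, 2, 7}, {4}} then \<one> else \<zero>)"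

definition "H = {r \<otimes>\<^bsub>Q.P\<^esub> e \<oplus>\<^bsub>Q.P\<^esub> s | r s. r \<in> carrier R.P \<and> s \<in> J}"

lemma RQ: "r \<in> carrier R.P \<Longrightarrow> r \<in> carrier Q.P" "r \<in> rpart R.P p \<Longrightarrow> r \<in> rpart Q.P p"
  using poly_super_ring_mono[of "{1, 2, 3, 4}" "{1..7}" A] by auto

lemma ops: "monoid.mult R.P = monoid.mult Q.P" "ring.add R.P = ring.add Q.P"
    "\<one>\<^bsub>R.P\<^esub> = \<one>\<^bsub>Q.P\<^esub>" "\<zero>\<^bsub>R.P\<^esub> = \<zero>\<^bsub>Q.P\<^esub>"
  by (rule poly_super_ring_ops)+

lemma R_outside: "r \<in> carrier R.P \<Longrightarrow> \<not> S \<subseteq> {1, 2, 3, 4} \<Longrightarrow> r S = \<zero>"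
  by (rule R.P_outside)

lemma R_mult_closed: "r \<in> carrier R.P \<Longrightarrow> s \<in> carrier R.P \<Longrightarrow> r \<otimes>\<^bsub>Q.P\<^esub> s \<in> carrier R.P"
  using R.P_mult_closed by (simp add: ops)

lemma R_add_closed: "r \<in> carrier R.P \<Longrightarrow> s \<in> carrier R.P \<Longrightarrow> r \<oplus>\<^bsub>Q.P\<^esub> s \<in> carrier R.P"
  using R.P_add_closed by (simp add: ops)

lemma Y_odd: "Y \<in> rpart R.P True"
  by (simp add: R.odd_gen_in_rpart)

lemma Y_closed: "Y \<in> carrier R.P" "Y \<in> carrier Q.P"
proof -
  show "Y \<in> carrier R.P" using Y_odd RR.rpart_subset by blast
  then show "Y \<in> carrier Q.P" by (rule RQ)
qed

lemma Y_Y_mult: "f \<in> carrier Q.P \<Longrightarrow> Y \<otimes>\<^bsub>Q.P\<^esub> (Y \<otimes>\<^bsub>Q.P\<^esub> f) = \<zero>\<^bsub>Q.P\<^esub>"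
  using QR.odd_square[OF RQ(2)[OF Y_odd]] Y_closed by (simp flip: QR.m_assoc)

lemma e_odd: "e \<in> rpart Q.P True"
  by (auto simp: Q.P_rpart Q.P_carrier e_def)

lemma e_closed: "e \<in> carrier Q.P"
  using e_odd QR.rpart_subset by auto

lemma J_subset: "s \<in> J \<Longrightarrow> s \<in> carrier R.P"
  by (simp add: J_def)

lemma J_closed: "s \<in> J \<Longrightarrow> s \<in> carrier Q.P"
  using J_subset RQ by blast

lemma J_card: "s \<in> J \<Longrightarrow> s S \<noteq> \<zero> \<Longrightarrow> 2 \<le> card (S \<inter> {1, 2, 3})"
  by (simp add: J_def)

lemma J_zero: "\<zero>\<^bsub>Q.P\<^esub> \<in> J"
  using RR.zero_closed by (simp add: J_def ops Q.P_zero)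

lemma J_add:
  assumes "s \<in> J" "t \<in> J"
  shows "s \<oplus>\<^bsub>Q.P\<^esub> t \<in> J"
proof -
  have "2 \<le> card (S \<inter> {1, 2, 3})" if "(s \<oplus>\<^bsub>Q.P\<^esub> t) S \<noteq> \<zero>" for S
  proof -
    have "s S \<noteq> \<zero> \<or> t S \<noteq> \<zero>" using that by (auto simp: Q.P_add)
    then show ?thesis using assms J_card by blast
  qed
  then show ?thesis using assms R_add_closed by (simp add: J_def)
qed

lemma mult_nonzeroE:
  assumes "f \<in> carrier Q.P" "g \<in> carrier Q.P" "(f \<otimes>\<^bsub>Q.P\<^esub> g) S \<noteq> \<zero>"
  obtains T where "T \<subseteq> S" "f T \<noteq> \<zero>" "g (S - T) \<noteq> \<zero>"
  using Q.P_mult_zero[OF assms(1,2), of S] assms(3) by blast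

lemma card_Int_mono: "T \<subseteq> S \<Longrightarrow> card (T \<inter> {1, 2, 3 :: nat}) \<le> card (S \<inter> {1, 2, 3})"
  by (intro card_mono) auto

text \<open>A monomial of the product contains one of the factor \<open>s\<close>, so the number of
  \<open>Z_i\<close> in it does not drop.\<close>

lemma J_mult:
  assumes r: "r \<in> carrier R.P" and s: "s \<in> J"
  shows "r \<otimes>\<^bsub>Q.P\<^esub> s \<in> J" "s \<otimes>\<^bsub>Q.P\<^esub> r \<in> J"
proof -
  have *: "2 \<le> card (S \<inter> {1, 2, 3})" if "T \<subseteq> S" "s T \<noteq> \<zero>" for S T
    using J_card[OF s that(2)] card_Int_mono[OF that(1)] by linarith
  have "2 \<le> card (S \<inter> {1, 2, 3})" if "(r \<otimes>\<^bsub>Q.P\<^esub> s) S \<noteq> \<zero>" for S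
    using mult_nonzeroE[OF RQ(1)[OF r] J_closed[OF s] that] * Diff_subset by metis
  then show "r \<otimes>\<^bsub>Q.P\<^esub> s \<in> J" using r J_subset[OF s] by (simp add: J_def R_mult_closed)
  have "2 \<le> card (S \<inter> {1, 2, 3})" if "(s \<otimes>\<^bsub>Q.P\<^esub> r) S \<noteq> \<zero>" for S
    using mult_nonzeroE[OF J_closed[OF s] RQ(1)[OF r] that] * by metis
  then show "s \<otimes>\<^bsub>Q.P\<^esub> r \<in> J" using r J_subset[OF s] by (simp add: J_def R_mult_closed)
qed

text \<open>Four distinct generators from \<open>Z\<^sub>1, Z\<^sub>2, Z\<^sub>3\<close> would be needed for a nonzero product.\<close>

lemma J_mult_eq_zero:
  assumes s: "s \<in> J" and f: "f \<in> carrier Q.P"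
    and supp: "\<And>S. f S \<noteq> \<zero> \<Longrightarrow> 2 \<le> card (S \<inter> {1, 2, 3})"
  shows "s \<otimes>\<^bsub>Q.P\<^esub> f = \<zero>\<^bsub>Q.P\<^esub>"
proof (rule ccontr)
  assume "s \<otimes>\<^bsub>Q.P\<^esub> f \<noteq> \<zero>\<^bsub>Q.P\<^esub>"
  then obtain S where "(s \<otimes>\<^bsub>Q.P\<^esub> f) S \<noteq> \<zero>" by (auto simp: fun_eq_iff Q.P_zero)
  then obtain T where T: "T \<subseteq> S" "s T \<noteq> \<zero>" "f (S - T) \<noteq> \<zero>"
    by (rule mult_nonzeroE[OF J_closed[OF s] f])
  let ?U = "T \<inter> {1, 2, 3}" and ?W = "(S - T) \<inter> {1, 2, 3}"
  have "card (?U \<union> ?W) = card ?U + card ?W" by (intro card_Un_disjoint) auto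
  moreover have "card (?U \<union> ?W) \<le> card {1, 2, 3 :: nat}" by (intro card_mono) auto
  ultimately show False using J_card[OF s T(2)] supp[OF T(3)] by simp
qed

text \<open>Every monomial of \<open>e\<close> other than \<open>Y\<close> contains two of the
  \<open>Z_i\<close>, so \<open>J\<close> annihilates the difference of \<open>e\<close> and
  \<open>Y\<close>.\<close>

lemma J_mult_e:
  assumes s: "s \<in> J"
  shows "s \<otimes>\<^bsub>Q.P\<^esub> e = s \<otimes>\<^bsub>Q.P\<^esub> Y"
proof -
  define E where "E = (\<lambda>S. if S \<in> {{2, 3, 5}, {1, 3, 6}, {1, 2, 7 :: nat}} then \<one> else \<zero>)"
  have E: "E \<in> carrier Q.P" by (auto simp: Q.P_carrier E_def)
  have "{2, 3, 5} \<inter> {1, 2, 3} = {2, 3 :: nat}" "{1, 3, 6} \<inter> {1, 2, 3} = {1, 3 :: nat}"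
    "{1, 2, 7} \<inter> {1, 2, 3} = {1, 2 :: nat}" by auto
  then have "s \<otimes>\<^bsub>Q.P\<^esub> E = \<zero>\<^bsub>Q.P\<^esub>"
    by (intro J_mult_eq_zero[OF s E]) (auto simp: E_def split: if_splits)
  moreover have "e = E \<oplus>\<^bsub>Q.P\<^esub> Y"
    by (auto simp: fun_eq_iff e_def E_def odd_gen_def Q.P_add)
  ultimately show ?thesis
    using J_closed[OF s] E Y_closed by (simp add: QR.r_distr)
qed

lemma mult_Y_support:
  assumes "f \<in> carrier Q.P" "4 \<notin> S"
  shows "(f \<otimes>\<^bsub>Q.P\<^esub> Y) S = \<zero>"
  using assms by (intro Q.P_mult_zero[OF assms(1) Y_closed(2)]) (auto simp: odd_gen_def)

text \<open>Index \<open>4\<close> is outside \<open>{1, 2, 3}\<close>, so stripping it leaves the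
  number of \<open>Z_i\<close> unchanged and the cofactor stays in \<open>J\<close>.\<close>

lemma J_Y_divisible:
  assumes "w \<in> J" "\<And>S. 4 \<notin> S \<Longrightarrow> w S = \<zero>"
  shows "\<exists>t\<in>J. w = Y \<otimes>\<^bsub>Q.P\<^esub> t"
proof
  have w: "w \<in> carrier R.P" using assms(1) by (rule J_subset)
  show "w = Y \<otimes>\<^bsub>Q.P\<^esub> R.contract 4 w"
    using R.odd_gen_mult_contract[of 4 w] w assms(2) by (auto simp: ops)
  have "w (insert 4 S) \<noteq> \<zero>" if "R.contract 4 w S \<noteq> \<zero>" for S
    using that by (auto simp: R.contract_def split: if_splits)
  then have "2 \<le> card (S \<inter> {1, 2, 3})" if "R.contract 4 w S \<noteq> \<zero>" for S
    using J_card[OF assms(1), of "insert 4 S"] that by simp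
  then show "R.contract 4 w \<in> J"
    using w by (simp add: J_def R.contract_closed)
qed

lemma HI: "r \<in> carrier R.P \<Longrightarrow> s \<in> J \<Longrightarrow> r \<otimes>\<^bsub>Q.P\<^esub> e \<oplus>\<^bsub>Q.P\<^esub> s \<in> H"
  by (auto simp: H_def)

lemma HE:
  assumes "x \<in> H"
  obtains r s where "r \<in> carrier R.P" "s \<in> J" "x = r \<otimes>\<^bsub>Q.P\<^esub> e \<oplus>\<^bsub>Q.P\<^esub> s"
  using assms by (auto simp: H_def)

lemma H_closed: "x \<in> H \<Longrightarrow> x \<in> carrier Q.P"
  using RQ J_closed e_closed by (auto simp: H_def)

lemma H_add:
  assumes "x \<in> H" "y \<in> H"
  shows "x \<oplus>\<^bsub>Q.P\<^esub> y \<in> H"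
proof -
  obtain r s where rs: "r \<in> carrier R.P" "s \<in> J" "x = r \<otimes>\<^bsub>Q.P\<^esub> e \<oplus>\<^bsub>Q.P\<^esub> s"
    using assms(1) by (rule HE)
  obtain r' s' where rs': "r' \<in> carrier R.P" "s' \<in> J" "y = r' \<otimes>\<^bsub>Q.P\<^esub> e \<oplus>\<^bsub>Q.P\<^esub> s'"
    using assms(2) by (rule HE)
  have "x \<oplus>\<^bsub>Q.P\<^esub> y = (r \<oplus>\<^bsub>Q.P\<^esub> r') \<otimes>\<^bsub>Q.P\<^esub> e \<oplus>\<^bsub>Q.P\<^esub> (s \<oplus>\<^bsub>Q.P\<^esub> s')"
    using rs rs' RQ(1) J_closed e_closed by (simp add: QR.l_distr QR.a_ac)
  then show ?thesis using rs rs' HI R_add_closed J_add by simp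
qed

lemma H_mult:
  assumes "r \<in> carrier R.P" "x \<in> H"
  shows "r \<otimes>\<^bsub>Q.P\<^esub> x \<in> H"
proof -
  obtain r' s where rs: "r' \<in> carrier R.P" "s \<in> J" "x = r' \<otimes>\<^bsub>Q.P\<^esub> e \<oplus>\<^bsub>Q.P\<^esub> s"
    using assms(2) by (rule HE)
  have "r \<otimes>\<^bsub>Q.P\<^esub> x = (r \<otimes>\<^bsub>Q.P\<^esub> r') \<otimes>\<^bsub>Q.P\<^esub> e \<oplus>\<^bsub>Q.P\<^esub> r \<otimes>\<^bsub>Q.P\<^esub> s"
    using assms(1) rs RQ(1) J_closed e_closed by (simp add: QR.r_distr QR.m_assoc)
  then show ?thesis using assms(1) rs HI R_mult_closed J_mult by simp
qed

lemma J_subset_H: "s \<in> J \<Longrightarrow> s \<in> H"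
  using HI[OF RR.zero_closed, of s] e_closed J_closed by (simp add: ops)

lemma e_in_H: "e \<in> H"
  using HI[OF RR.one_closed J_zero] e_closed by (simp add: ops)

text \<open>The parity parts arise by restricting the support, and \<open>J\<close> is defined by
  supports, so it contains both parts of its elements.\<close>

lemma R_split:
  assumes "r \<in> carrier R.P"
  obtains u v where "u \<in> rpart R.P False" "v \<in> rpart R.P True" "r = u \<oplus>\<^bsub>Q.P\<^esub> v"
    "r \<in> J \<Longrightarrow> u \<in> J" "r \<in> J \<Longrightarrow> v \<in> J"
proof
  let ?u = "\<lambda>p S. if odd (card S) = p then r S else \<zero>"
  show "?u False \<in> rpart R.P False" "?u True \<in> rpart R.P True"
    using assms by (auto simp: R.P_rpart R.P_carrier)
  then show "?u False \<in> J" "?u True \<in> J" if "r \<in> J"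
    using that by (auto simp: J_def R.P_rpart)
  show "r = ?u False \<oplus>\<^bsub>Q.P\<^esub> ?u True"
    using R.P_carrierD[OF assms] by (auto simp: Q.P_add)
qed

text \<open>Since \<open>e\<close> is odd, the even part of \<open>r e\<close> comes from the odd
  part of \<open>r\<close>, and vice versa.\<close>

lemma H_graded:
  assumes "x \<in> H"
  shows "\<exists>u\<in>H \<inter> rpart Q.P False. \<exists>v\<in>H \<inter> rpart Q.P True. x = u \<oplus>\<^bsub>Q.P\<^esub> v"
proof -
  obtain r s where rs: "r \<in> carrier R.P" "s \<in> J" "x = r \<otimes>\<^bsub>Q.P\<^esub> e \<oplus>\<^bsub>Q.P\<^esub> s"
    using assms by (rule HE)
  obtain u v where uv: "u \<in> rpart R.P False" "v \<in> rpart R.P True" "r = u \<oplus>\<^bsub>Q.P\<^esub> v"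
    using R_split[OF rs(1)] by metis
  obtain a b where ab: "a \<in> rpart R.P False" "b \<in> rpart R.P True" "s = a \<oplus>\<^bsub>Q.P\<^esub> b" "a \<in> J" "b \<in> J"
    using R_split[OF J_subset[OF rs(2)]] rs(2) by metis
  have uvc: "u \<in> carrier R.P" "v \<in> carrier R.P" using uv RR.rpart_subset by auto
  have sub: "additive_subgroup (rpart Q.P p) Q.P" for p
    using QR.grading by (simp add: Z2_grading_def)
  have "v \<otimes>\<^bsub>Q.P\<^esub> e \<oplus>\<^bsub>Q.P\<^esub> a \<in> rpart Q.P False"
    using QR.mult_part[OF RQ(2)[OF uv(2)] e_odd] RQ(2)[OF ab(1)] additive_subgroup.a_closed[OF sub]
    by simp
  moreover have "u \<otimes>\<^bsub>Q.P\<^esub> e \<oplus>\<^bsub>Q.P\<^esub> b \<in> rpart Q.P True"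
    using QR.mult_part[OF RQ(2)[OF uv(1)] e_odd] RQ(2)[OF ab(2)] additive_subgroup.a_closed[OF sub]
    by simp
  moreover have "x = (v \<otimes>\<^bsub>Q.P\<^esub> e \<oplus>\<^bsub>Q.P\<^esub> a) \<oplus>\<^bsub>Q.P\<^esub> (u \<otimes>\<^bsub>Q.P\<^esub> e \<oplus>\<^bsub>Q.P\<^esub> b)"
    using rs(3) uv(3) ab(3-5) uvc RQ(1) J_closed e_closed by (simp add: QR.l_distr QR.a_ac)
  ultimately show ?thesis using HI uvc ab by blast
qed

abbreviation M where "M \<equiv> sub_supermodule Q.P H"

lemma supermodule_M: "supermodule R.P M"
  by (rule supermodule_sub_supermodule[OF R.super_ring_P Q.super_ring_P])
     (use RQ H_closed H_add H_mult H_graded J_zero J_subset_H in \<open>auto simp: ops\<close>)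

lemma M_simps: "carrier M = H" "(\<odot>\<^bsub>M\<^esub>) = (\<otimes>\<^bsub>Q.P\<^esub>)" "\<zero>\<^bsub>M\<^esub> = \<zero>\<^bsub>Q.P\<^esub>"
  by (simp_all add: sub_supermodule_def)

section \<open>The kernel of multiplication by \<open>Y\<close>\<close>

lemma e_support:
  assumes "e S \<noteq> \<zero>"
  shows "4 \<in> S \<or> 5 \<in> S \<and> S = {2, 3, 5} \<or> 6 \<in> S \<and> S = {1, 3, 6} \<or> 7 \<in> S \<and> S = {1, 2, 7}"
proof -
  have "S \<in> {{2, 3, 5}, {1, 3, 6}, {1, 2, 7}, {4}}"
    using assms unfolding e_def by presburger
  then show ?thesis by (elim insertE emptyE) (simp only: insert_iff simp_thms; simp)+
qed

text \<open>\<open>D\<close> is the only monomial of \<open>e\<close> inside \<open>T \<union> D\<close>, so the coefficient of \<open>r e\<close> at \<open>T \<union> D\<close>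
  is that of \<open>r\<close> at \<open>T\<close> up to sign.\<close>

lemma coefficient_zero:
  assumes r: "r \<in> carrier R.P" and zero: "(r \<otimes>\<^bsub>Q.P\<^esub> e) (T \<union> D) = \<zero>"
    and D: "D \<in> {{2, 3, 5}, {1, 3, 6}, {1, 2, 7}}" and T: "T \<subseteq> {1, 2, 3}" "T \<inter> D = {}"
  shows "r T = \<zero>"
proof -
  have eD: "e D = \<one>" using D by (auto simp: e_def)
  have T': "4 \<notin> T" "5 \<notin> T" "6 \<notin> T" "7 \<notin> T" using T(1) by auto
  have D': "4 \<notin> D" "5 \<in> D \<Longrightarrow> D = {2, 3, 5}" "6 \<in> D \<Longrightarrow> D = {1, 3, 6}" "7 \<in> D \<Longrightarrow> D = {1, 2, 7}"
    using D by auto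
  have fin: "finite (T \<union> D)" using D T(1) finite_subset by auto
  have TD: "T \<union> D - T = D" using T(2) by auto
  have "(r \<otimes>\<^bsub>Q.P\<^esub> e) (T \<union> D) = Q.psign (inversions T D) \<otimes> (r T \<otimes> e D)"
  proof (subst Q.P_mult_single[OF RQ(1)[OF r] e_closed fin, of T])
    show "r U = \<zero> \<or> e (T \<union> D - U) = \<zero>" if U: "U \<subseteq> T \<union> D" "U \<noteq> T" for U
    proof (rule disjCI)
      assume "e (T \<union> D - U) \<noteq> \<zero>"
      from e_support[OF this] have "T \<union> D - U = D"
      proof (elim disjE conjE)
        assume "5 \<in> T \<union> D - U" "T \<union> D - U = {2, 3, 5}"
        then show ?thesis using T'(2) D'(2) by (metis DiffD1 UnE)
      next
        assume "6 \<in> T \<union> D - U" "T \<union> D - U = {1, 3, 6}"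
        then show ?thesis using T'(3) D'(3) by (metis DiffD1 UnE)
      next
        assume "7 \<in> T \<union> D - U" "T \<union> D - U = {1, 2, 7}"
        then show ?thesis using T'(4) D'(4) by (metis DiffD1 UnE)
      qed (use T'(1) D'(1) in simp)
      then have "U = T" using U(1) T(2) by auto
      then show "r U = \<zero>" using U(2) by simp
    qed
  qed (auto simp: TD)
  then have "Q.psign (inversions T D) \<otimes> r T = \<zero>"
    using zero eD R.P_carrierD[OF r, of T] by simp
  then show ?thesis using Q.psign_mult_eq_zero_iff[OF R.P_carrierD[OF r]] by blast
qed

text \<open>Each cubic monomial of \<open>e\<close> omits one \<open>Z_i\<close>. A set
  \<open>S\<close> with at most one \<open>Z_i\<close> and without \<open>Y\<close> is therefore
  disjoint from one of them, \<open>D\<close>. As \<open>S \<union> D\<close> contains one of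
  \<open>5\<close>, \<open>6\<close>, \<open>7\<close>, the coefficient of \<open>r e\<close>
  vanishes there, hence also that of \<open>r\<close> at \<open>S\<close>.\<close>

lemma low_coefficients:
  assumes r: "r \<in> carrier R.P"
    and zero: "\<And>S. 4 \<notin> S \<Longrightarrow> \<not> S \<subseteq> {1, 2, 3, 4} \<Longrightarrow> (r \<otimes>\<^bsub>Q.P\<^esub> e) S = \<zero>"
    and S: "4 \<notin> S" "r S \<noteq> \<zero>"
  shows "2 \<le> card (S \<inter> {1, 2, 3})"
proof (rule ccontr)
  assume c: "\<not> 2 \<le> card (S \<inter> {1, 2, 3})"
  have "S \<subseteq> {1, 2, 3, 4}" using S(2) R_outside[OF r] by blast
  then have sub: "S \<subseteq> {1, 2, 3}" using S(1) by auto
  then have fin: "finite S" and "S \<inter> {1, 2, 3} = S" using finite_subset by auto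
  then have "card S < 2" using c by simp
  then have "card S = 0 \<or> card S = 1" by linarith
  then have "S = {} \<or> (\<exists>i. S = {i})"
    using fin card_1_singleton_iff[of S] by (auto simp: One_nat_def)
  then consider "S = {} \<or> S = {1}" | "S = {2}" | "S = {3}" using sub by blast
  then obtain D where D: "D \<in> {{2, 3, 5}, {1, 3, 6}, {1, 2, 7}}" "S \<inter> D = {}"
  proof cases
    case 1
    then show ?thesis by (intro that[of "{2, 3, 5}"]) auto
  next
    case 2
    then show ?thesis by (intro that[of "{1, 3, 6}"]) auto
  next
    case 3
    then show ?thesis by (intro that[of "{1, 2, 7}"]) auto
  qed
  then have "(r \<otimes>\<^bsub>Q.P\<^esub> e) (S \<union> D) = \<zero>"
    using S(1) by (intro zero) auto
  then show False using coefficient_zero[OF r _ D(1) sub D(2)] S(2) by blast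
qed

text \<open>Write \<open>r = Y c + d\<close> with \<open>d\<close> free of \<open>Y\<close>. Once
  \<open>d\<close> is known to lie in \<open>J\<close>, \<open>d e = d Y\<close>, and what remains
  of \<open>x\<close> beside \<open>Y (c e)\<close> is an element of \<open>J\<close> killed by
  \<open>Y\<close>, hence divisible by \<open>Y\<close> within \<open>J\<close>.\<close>

lemma Y_kernel:
  assumes x: "x \<in> H" and Yx: "Y \<otimes>\<^bsub>Q.P\<^esub> x = \<zero>\<^bsub>Q.P\<^esub>"
  shows "\<exists>y\<in>H. x = Y \<otimes>\<^bsub>Q.P\<^esub> y"
proof -
  obtain r s where rs: "r \<in> carrier R.P" "s \<in> J" "x = r \<otimes>\<^bsub>Q.P\<^esub> e \<oplus>\<^bsub>Q.P\<^esub> s"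
    using x by (rule HE)
  have x4: "x S = \<zero>" if "4 \<notin> S" for S
    using Q.odd_gen_mult_eq_zeroD[OF _ H_closed[OF x] Yx that] by simp
  have re: "r \<otimes>\<^bsub>Q.P\<^esub> e \<in> carrier Q.P" using rs(1) RQ(1) e_closed by simp
  define c where "c = R.contract 4 r"
  define d where "d = (\<lambda>S. if 4 \<in> S then \<zero> else r S)"
  have c: "c \<in> carrier R.P" using rs(1) by (simp add: c_def R.contract_closed)
  have dR: "d \<in> carrier R.P" using rs(1) by (auto simp: d_def R.P_carrier)
  \<comment> \<open>Outside the subsets of \<open>{1, 2, 3, 4}\<close> the element \<open>s\<close>
    of \<open>R.P\<close> has no coefficients, so the vanishing of \<open>x\<close> passes to
    \<open>r e\<close>.\<close>
  have "(r \<otimes>\<^bsub>Q.P\<^esub> e) S = \<zero>" if "4 \<notin> S" "\<not> S \<subseteq> {1, 2, 3, 4}" for S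
    using x4[OF that(1)] R_outside[OF J_subset[OF rs(2)] that(2)] Q.P_carrierD[OF re]
    by (simp add: rs(3) Q.P_add)
  from low_coefficients[OF rs(1) this] have d: "d \<in> J"
    using dR by (auto simp: J_def d_def)
  have r: "r = Y \<otimes>\<^bsub>Q.P\<^esub> c \<oplus>\<^bsub>Q.P\<^esub> d"
    unfolding c_def d_def using R.odd_gen_decomposition[of 4 r] rs(1) by (simp add: ops)
  define w where "w = d \<otimes>\<^bsub>Q.P\<^esub> Y \<oplus>\<^bsub>Q.P\<^esub> s"
  have w: "w \<in> J" unfolding w_def using d rs(2) Y_closed(1) by (intro J_add J_mult)
  have xw: "x = Y \<otimes>\<^bsub>Q.P\<^esub> (c \<otimes>\<^bsub>Q.P\<^esub> e) \<oplus>\<^bsub>Q.P\<^esub> w"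
    unfolding rs(3) w_def J_mult_e[OF d, symmetric] r
    using Y_closed(2) RQ(1)[OF c] RQ(1)[OF dR] e_closed J_closed[OF rs(2)]
    by (simp add: QR.l_distr QR.m_assoc QR.a_assoc)
  have ce: "c \<otimes>\<^bsub>Q.P\<^esub> e \<in> carrier Q.P" using RQ(1)[OF c] e_closed by simp
  \<comment> \<open>As \<open>Y\<close> squares to zero, \<open>Y w\<close> equals
    \<open>Y x\<close>.\<close>
  have "Y \<otimes>\<^bsub>Q.P\<^esub> w = \<zero>\<^bsub>Q.P\<^esub>"
    using Yx Y_closed(2) ce J_closed[OF w] by (simp add: xw QR.r_distr Y_Y_mult)
  then have "w S = \<zero>" if "4 \<notin> S" for S
    using Q.odd_gen_mult_eq_zeroD[OF _ J_closed[OF w] _ that] by simp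
  then obtain t where t: "t \<in> J" "w = Y \<otimes>\<^bsub>Q.P\<^esub> t" using J_Y_divisible[OF w] by blast
  have "x = Y \<otimes>\<^bsub>Q.P\<^esub> (c \<otimes>\<^bsub>Q.P\<^esub> e \<oplus>\<^bsub>Q.P\<^esub> t)"
    using Y_closed(2) ce J_closed[OF t(1)] by (simp add: xw t(2) QR.r_distr)
  then show ?thesis using HI[OF c t(1)] by blast
qed

lemma Y_regular: "odd_regular R.P M Y"
  unfolding odd_regular_def M_simps
  using Y_odd Y_kernel Y_Y_mult H_closed H_mult[OF Y_closed(1)] by auto

section \<open>Products of odd elements on the module\<close>

text \<open>The product \<open>p\<close> is even without constant term, so its monomials free of
  \<open>Y\<close> contain at least two \<open>Z_i\<close>, and \<open>p = Y c + d\<close> with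
  \<open>d\<close> in \<open>J\<close>. Since \<open>J\<close> kills \<open>J\<close> and the
  difference of \<open>e\<close> and \<open>Y\<close>, \<open>d x\<close> equals
  \<open>(d r) Y\<close>, which is \<open>Y\<close> times an element of \<open>J\<close>.\<close>

lemma odd_odd_mult:
  assumes a: "a \<in> rpart R.P True" and b: "b \<in> rpart R.P True" and x: "x \<in> H"
  shows "(a \<otimes>\<^bsub>Q.P\<^esub> b) \<otimes>\<^bsub>Q.P\<^esub> x \<in> (\<otimes>\<^bsub>Q.P\<^esub>) Y ` H"
proof -
  define p where "p = a \<otimes>\<^bsub>Q.P\<^esub> b"
  have pe: "p \<in> rpart R.P False" using RR.mult_part[OF a b] by (simp add: p_def ops)
  then have p: "p \<in> carrier R.P" using RR.rpart_subset by blast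
  have ac: "a \<in> carrier R.P" "b \<in> carrier R.P" using a b RR.rpart_subset by auto
  have "a {} = \<zero>" using a by (auto simp: R.P_rpart)
  then have p0: "p {} = \<zero>"
    unfolding p_def by (intro Q.P_mult_zero) (use ac RQ(1) in auto)
  obtain r s where rs: "r \<in> carrier R.P" "s \<in> J" "x = r \<otimes>\<^bsub>Q.P\<^esub> e \<oplus>\<^bsub>Q.P\<^esub> s"
    using x by (rule HE)
  define c where "c = R.contract 4 p"
  define d where "d = (\<lambda>S. if 4 \<in> S then \<zero> else p S)"
  have c: "c \<in> carrier R.P" using p by (simp add: c_def R.contract_closed)
  have dR: "d \<in> carrier R.P" using p by (auto simp: d_def R.P_carrier)
  have "2 \<le> card (S \<inter> {1, 2, 3})" if "d S \<noteq> \<zero>" for S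
  proof -
    have S: "4 \<notin> S" "p S \<noteq> \<zero>" using that by (auto simp: d_def split: if_splits)
    then have "S \<subseteq> {1, 2, 3, 4}" using R_outside[OF p] by blast
    then have "S \<inter> {1, 2, 3} = S" "finite S" using S(1) finite_subset by auto
    moreover have "even (card S)" "S \<noteq> {}" using S(2) pe p0 by (auto simp: R.P_rpart)
    ultimately show ?thesis by (metis card_0_eq dvd_imp_le gr0I)
  qed
  then have d: "d \<in> J" using dR by (simp add: J_def)
  have pcd: "p = Y \<otimes>\<^bsub>Q.P\<^esub> c \<oplus>\<^bsub>Q.P\<^esub> d"
    unfolding c_def d_def using R.odd_gen_decomposition[of 4 p] p by (simp add: ops)
  have dr: "d \<otimes>\<^bsub>Q.P\<^esub> r \<in> J" using rs(1) d by (rule J_mult)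
  have "d \<otimes>\<^bsub>Q.P\<^esub> s = \<zero>\<^bsub>Q.P\<^esub>"
    by (rule J_mult_eq_zero[OF d J_closed[OF rs(2)] J_card[OF rs(2)]])
  then have "d \<otimes>\<^bsub>Q.P\<^esub> x = (d \<otimes>\<^bsub>Q.P\<^esub> r) \<otimes>\<^bsub>Q.P\<^esub> Y"
    unfolding rs(3) J_mult_e[OF dr, symmetric]
    using RQ(1)[OF dR] RQ(1)[OF rs(1)] J_closed[OF rs(2)] e_closed by (simp add: QR.r_distr QR.m_assoc)
  moreover obtain t where t: "t \<in> J" "(d \<otimes>\<^bsub>Q.P\<^esub> r) \<otimes>\<^bsub>Q.P\<^esub> Y = Y \<otimes>\<^bsub>Q.P\<^esub> t"
    using J_Y_divisible[OF J_mult(2)[OF Y_closed(1) dr]] mult_Y_support[OF J_closed[OF dr]] by blast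
  ultimately have "p \<otimes>\<^bsub>Q.P\<^esub> x = Y \<otimes>\<^bsub>Q.P\<^esub> (c \<otimes>\<^bsub>Q.P\<^esub> x \<oplus>\<^bsub>Q.P\<^esub> t)"
    using RQ(1)[OF dR] RQ(1)[OF c] Y_closed(2) H_closed[OF x] J_closed[OF t(1)]
    by (simp add: pcd QR.l_distr QR.r_distr QR.m_assoc)
  moreover have "c \<otimes>\<^bsub>Q.P\<^esub> x \<oplus>\<^bsub>Q.P\<^esub> t \<in> H"
    using H_add H_mult[OF c x] J_subset_H[OF t(1)] by blast
  ultimately show ?thesis by (auto simp: p_def)
qed

text \<open>At the coefficient of \<open>{1, 2, 3, 4}\<close>, peeling off the generators one at a
  time leaves \<open>e {4} = \<one>\<close> up to sign.\<close>

lemma odd_gens_mult_e: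
  assumes "\<one> \<noteq> \<zero>"
  shows "list_prod R.P [odd_gen A 1, odd_gen A 2, odd_gen A 3] \<otimes>\<^bsub>Q.P\<^esub> e \<noteq> \<zero>\<^bsub>Q.P\<^esub>"
proof -
  have g: "odd_gen A i \<in> carrier Q.P" if "i \<in> {1..7}" for i
    using Q.odd_gen_in_rpart[OF that] QR.rpart_subset by blast
  have "list_prod R.P [odd_gen A 1, odd_gen A 2, odd_gen A 3] \<otimes>\<^bsub>Q.P\<^esub> e
      = odd_gen A 1 \<otimes>\<^bsub>Q.P\<^esub> (odd_gen A 2 \<otimes>\<^bsub>Q.P\<^esub> (odd_gen A 3 \<otimes>\<^bsub>Q.P\<^esub> e))" (is "_ = ?x")
    using g e_closed by (simp add: ops QR.m_assoc)
  moreover have "?x {1, 2, 3, 4} \<noteq> \<zero>"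
  proof -
    have "{1, 2, 3, 4} - {1} = {2, 3, 4 :: nat}" "{2, 3, 4} - {2} = {3, 4 :: nat}"
      "{3, 4} - {3} = {4 :: nat}" by auto
    moreover have "e {4} = \<one>" by (simp add: e_def)
    moreover have "Q.psign n \<noteq> \<zero>" for n
      using Q.psign_mult_eq_zero_iff[OF one_closed, of n] assms by simp
    ultimately show ?thesis
      using g e_closed assms by (simp add: Q.odd_gen_mult Q.psign_mult_eq_zero_iff)
  qed
  ultimately show ?thesis by (metis Q.P_zero)
qed

end

theorem mainTheorem11:
  fixes A :: "('a, 'b) ring_scheme"
  assumes "artinian_cring A" and "carrier A \<noteq> {\<zero>\<^bsub>A\<^esub>}"
  shows "let R = poly_super_ring A {1, 2, 3, 4}; Y = odd_gen A 4 in
    \<exists>M :: (nat set \<Rightarrow> 'a, nat \<Rightarrow> 'a set) supermodule.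
      supermodule R M \<and> carrier M \<noteq> {\<zero>\<^bsub>M\<^esub>} \<and>
      odd_regular R M Y \<and>
      sdim1 R (quotient_supermodule M (carrier (mult_submodule Y M))) < sdim1 R M - 1 \<and>
      (\<forall>ys. longest_odd_parameters R M ys \<longrightarrow> Y \<notin> set ys)"
proof -
  note One_nat_def [simp del]
  interpret artinian_cring A by fact
  interpret gap_example A ..
  \<comment> \<open>Coefficients are indexed by naturals through \<open>set_decode\<close>, and
    singletons place them in the type \<open>'a set\<close>.\<close>
  define h :: "(nat set \<Rightarrow> 'a) \<Rightarrow> nat \<Rightarrow> 'a set" where "h = (\<lambda>f n. {f (set_decode n)})"
  have "inj_on h (carrier M)"
  proof (rule inj_onI)
    fix x y assume xy: "x \<in> carrier M" "y \<in> carrier M" "h x = h y"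
    \<comment> \<open>Every finite set is reached by \<open>set_decode\<close>, and both families
      vanish off the subsets of \<open>{1..7}\<close>, so no coefficient is lost.\<close>
    have "x S = y S" for S
    proof (cases "S \<subseteq> {1..7}")
      case True
      then have "finite S" using finite_subset by blast
      then show ?thesis using fun_cong[OF xy(3), of "set_encode S"] by (simp add: h_def)
    next
      case False
      have "x \<in> carrier Q.P" "y \<in> carrier Q.P"
        using xy(1,2) H_closed unfolding M_simps by blast+
      then show ?thesis using Q.P_outside[OF _ False] by metis
    qed
    then show "x = y" by blast
  qed
  then interpret supermodule_transport R.P M h
    by (intro supermodule_transport.intro supermodule_M supermodule_transport_axioms.intro)
  have nz: "\<one>\<^bsub>A\<^esub> \<noteq> \<zero>\<^bsub>A\<^esub>" using assms(2) one_zeroD by blast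
  let ?zs = "[odd_gen A 1, odd_gen A 2, odd_gen A 3]"
  have zs: "set ?zs \<subseteq> rpart R.P True" by (simp add: R.odd_gen_in_rpart)
  have reg: "odd_regular R.P T Y" by (rule transport_odd_regular[OF Y_regular])
  have sq: "(a \<otimes>\<^bsub>R.P\<^esub> b) \<odot>\<^bsub>T\<^esub> x \<in> (\<odot>\<^bsub>T\<^esub>) Y ` carrier T"
    if ab: "a \<in> rpart R.P True" "b \<in> rpart R.P True" and x: "x \<in> carrier T" for a b x
  proof -
    obtain m where m: "m \<in> H" "x = h m" using x by (auto simp: transport_carrier M_simps)
    then show ?thesis
      using odd_odd_mult[OF ab m(1)] unfolding transport_image_smult
      by (simp add: transport_smult M_simps ops)
  qed
  have he: "h e \<in> carrier T" using e_in_H by (simp add: transport_carrier M_simps)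
  have ne: "list_prod R.P ?zs \<odot>\<^bsub>T\<^esub> h e \<noteq> \<zero>\<^bsub>T\<^esub>"
  proof -
    have "list_prod R.P ?zs \<otimes>\<^bsub>Q.P\<^esub> e \<in> H"
      by (rule H_mult[OF RR.list_prod_closed[OF zs] e_in_H])
    then show ?thesis
      using odd_gens_mult_e[OF nz] e_in_H transport_eq_iff[of "list_prod R.P ?zs \<otimes>\<^bsub>Q.P\<^esub> e" "\<zero>\<^bsub>Q.P\<^esub>"] J_subset_H[OF J_zero]
      unfolding transport_zero M_simps by (simp add: transport_smult M_simps)
  qed
  show ?thesis
    unfolding Let_def
    using supermodule_transport reg
      R.sdim1_gap[OF assms(1) supermodule_transport reg sq zs _ he ne] by auto
qed

end
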